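(* Let $X\subset\mathbb{C}^d$ be compact, let $(T_i,w_i)_{i\in\mathcal I}$ be a $C^\omega$ map-weight system on $X$, and suppose that the Euclidean ball $D\subset\mathbb{C}^d$ is an admissible domain for $(T_i,w_i)_{i\in\mathcal I}$. Suppose that $\bigcup_{i\in\mathcal I}T_i(D)$ is contained in the ball concentric with $D$ whose radius is $r<1$ times that of $D$ (where $0<r<1$). Set $W:=\sup_{z\in D}\sum_{i\in\mathcal I}|w_i(z)|$. Let $\{\lambda_n(\mathcal L)\}_{n=1}^\infty$ be the Ruelle eigenvalue sequence, i.e. the eigenvalue sequence of the transfer operator $\mathcal L:U(D)\to U(D)$, $\mathcal L f=\sum_{i\in\mathcal I}w_i\cdot f\circ T_i$. Then for all $n\ge1$, $$|\lambda_n(\mathcal L)| < \min\left(n^{1/2},\ \frac{\sqrt d}{(1-r^2)^{d/2}}\, n^{(d-1)/(2d)}\right)\frac{W}{r^d}\, r^{\frac{d}{d+1}(d!)^{1/d}n^{1/d}}.$$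
   Context: $\mathbb{C}^d$ carries the Euclidean norm. A domain is a non-empty connected open set; $\mathcal D_d$ is the set of bounded domains in $\mathbb{C}^d$. For bounded sets, $\Delta_1\subset\subset\Delta_2$ means $\overline{\Delta_1}\subset\Delta_2$. For $D\in\mathcal D_d$ and a Banach space $B$, $U(D,B)$ is the Banach space of continuous functions $\overline D\to B$ that are holomorphic on $D$, with the supremum norm over $\overline D$; $U(D)=U(D,\mathbb{C})$. Let $\mathcal I$ be a non-empty countable set. A holomorphic map system on $D\in\mathcal D_d$ is a family $(T_i)_{i\in\mathcal I}$ with $T_i\in U(D,\mathbb{C}^d)$ and $\bigcup_{i}T_i(D)\subset\subset D$. A holomorphic weight system on $D$ is a family $(w_i)_{i\in\mathcal I}$ with $w_i\in U(D)$ and $\sum_{i}\|w_i\|_{U(D)}<\infty$. For $X\subset\mathbb{C}^d$ compact, a family of maps $T_i:X\to X$ (resp. $w_i:X\to\mathbb{C}$) is a $C^\omega$ map system (resp. $C^\omega$ weight system) on $X$ if there is $D\in\mathcal D_d$ with $X\subset\subset D$ such that the $T_i$ (resp. $w_i$) extend to $D$ and the extensions form a holomorphic map system (resp. holomorphic weight system) on $D$; any such $D$ is called admissible for it. A $C^\omega$ map-weight system is a pair consisting of a $C^\omega$ map system and a $C^\omega$ weight system on $X$ indexed by the same $\mathcal I$; a domain is admissible for it if it is admissible for both. The extensions are denoted by the same symbols. The transfer operator is a compact operator on $U(D)$. For a compact operator $L$, its eigenvalue sequence $\{\lambda_n(L)\}_{n=1}^\infty$ is the sequence of all (non-zero) eigenvalues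 counted with algebraic multiplicity and ordered by decreasing modulus (eigenvalues of equal modulus in any order), continued by zeros if there are only finitely many.
   Formalization: The hypothesis W ≠ 0 is added: if W = 0, all weights vanish on D, the transfer operator is zero, every eigenvalue is 0 and the right-hand side is 0, so the strict inequality as printed fails. *)

theory Defs
  imports "HOL-Analysis.Analysis" "HOL-Library.Function_Algebras"
begin

definition bounded_domain :: "(complex^'d) set \<Rightarrow> bool" where
  "bounded_domain D \<longleftrightarrow> D \<noteq> {} \<and> open D \<and> connected D \<and> bounded D"

definition compactly_inside :: "(complex^'d) set \<Rightarrow> (complex^'d) set \<Rightarrow> bool" where
  "compactly_inside A B \<longleftrightarrow> bounded A \<and> bounded B \<and> closure A \<subseteq> B"

text \<open>
  Holomorphy in several variables as complex Frechet differentiability: the real derivative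
  at each point is complex-linear. The complex structure of the codomain is passed
  explicitly as its scalar multiplication \<open>sc\<close>: \<open>(*)\<close> for \<open>complex\<close>,
  \<open>(*s)\<close> for \<open>complex^'m\<close>.
\<close>

definition holo_on ::
  "(complex \<Rightarrow> 'b \<Rightarrow> 'b) \<Rightarrow> (complex^'d \<Rightarrow> 'b::real_normed_vector) \<Rightarrow> (complex^'d) set \<Rightarrow> bool" where
  "holo_on sc f D \<longleftrightarrow>
     (\<forall>z\<in>D. \<exists>f'. (f has_derivative f') (at z) \<and> Vector_Spaces.linear (*s) sc f')"

text \<open>
  \<open>in_U sc D f\<close>: the restriction of the total function \<open>f\<close> to \<open>closure D\<close> belongs to \<open>U(D,B)\<close>.
  Values of \<open>f\<close> outside \<open>closure D\<close> are irrelevant.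
\<close>

definition in_U ::
  "(complex \<Rightarrow> 'b \<Rightarrow> 'b) \<Rightarrow> (complex^'d) set \<Rightarrow> (complex^'d \<Rightarrow> 'b::real_normed_vector) \<Rightarrow> bool" where
  "in_U sc D f \<longleftrightarrow> continuous_on (closure D) f \<and> holo_on sc f D"

definition U_norm :: "(complex^'d) set \<Rightarrow> (complex^'d \<Rightarrow> 'b::real_normed_vector) \<Rightarrow> real" where
  "U_norm D f = (SUP z\<in>closure D. norm (f z))"

text \<open>
  \<open>U(D)\<close> as a set of functions: each element is represented by the unique total function
  that vanishes outside \<open>closure D\<close>, so that linear algebra in the function space
  is linear algebra in \<open>U(D)\<close>.
\<close>

definition U_space :: "(complex^'d) set \<Rightarrow> (complex^'d \<Rightarrow> complex) set" where
  "U_space D = {f. in_U (*) D f \<and> (\<forall>z. z \<notin> closure D \<longrightarrow> f z = 0)}"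


definition holomorphic_map_system ::
  "(complex^'d) set \<Rightarrow> 'i set \<Rightarrow> ('i \<Rightarrow> complex^'d \<Rightarrow> complex^'d) \<Rightarrow> bool" where
  "holomorphic_map_system D I T \<longleftrightarrow>
     I \<noteq> {} \<and> countable I \<and> bounded_domain D \<and>
     (\<forall>i\<in>I. in_U (*s) D (T i)) \<and> compactly_inside (\<Union>i\<in>I. T i ` D) D"

definition holomorphic_weight_system ::
  "(complex^'d) set \<Rightarrow> 'i set \<Rightarrow> ('i \<Rightarrow> complex^'d \<Rightarrow> complex) \<Rightarrow> bool" where
  "holomorphic_weight_system D I w \<longleftrightarrow>
     I \<noteq> {} \<and> countable I \<and> bounded_domain D \<and>
     (\<forall>i\<in>I. in_U (*) D (w i)) \<and> (\<lambda>i. U_norm D (w i)) summable_on I"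

text \<open>
  \<open>T\<close> and \<open>w\<close> are the given systems on \<open>X\<close>; \<open>T'\<close> and \<open>w'\<close> are the chosen extensions to
  the admissible domain \<open>D\<close> (they need not be unique, for instance when \<open>X\<close> is finite).
\<close>

definition admissible_map ::
  "(complex^'d) set \<Rightarrow> 'i set \<Rightarrow> ('i \<Rightarrow> complex^'d \<Rightarrow> complex^'d) \<Rightarrow>
   (complex^'d) set \<Rightarrow> ('i \<Rightarrow> complex^'d \<Rightarrow> complex^'d) \<Rightarrow> bool" where
  "admissible_map X I T D T' \<longleftrightarrow>
     bounded_domain D \<and> compactly_inside X D \<and>
     (\<forall>i\<in>I. \<forall>x\<in>X. T' i x = T i x) \<and> holomorphic_map_system D I T'"

definition admissible_weight ::
  "(complex^'d) set \<Rightarrow> 'i set \<Rightarrow> ('i \<Rightarrow> complex^'d \<Rightarrow> complex) \<Rightarrow>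
   (complex^'d) set \<Rightarrow> ('i \<Rightarrow> complex^'d \<Rightarrow> complex) \<Rightarrow> bool" where
  "admissible_weight X I w D w' \<longleftrightarrow>
     bounded_domain D \<and> compactly_inside X D \<and>
     (\<forall>i\<in>I. \<forall>x\<in>X. w' i x = w i x) \<and> holomorphic_weight_system D I w'"

definition Comega_map_system ::
  "(complex^'d) set \<Rightarrow> 'i set \<Rightarrow> ('i \<Rightarrow> complex^'d \<Rightarrow> complex^'d) \<Rightarrow> bool" where
  "Comega_map_system X I T \<longleftrightarrow>
     (\<forall>i\<in>I. T i ` X \<subseteq> X) \<and> (\<exists>D T'. admissible_map X I T D T')"

definition Comega_weight_system ::
  "(complex^'d) set \<Rightarrow> 'i set \<Rightarrow> ('i \<Rightarrow> complex^'d \<Rightarrow> complex) \<Rightarrow> bool" where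
  "Comega_weight_system X I w \<longleftrightarrow> (\<exists>D w'. admissible_weight X I w D w')"

definition Comega_map_weight_system ::
  "(complex^'d) set \<Rightarrow> 'i set \<Rightarrow> ('i \<Rightarrow> complex^'d \<Rightarrow> complex^'d) \<Rightarrow>
   ('i \<Rightarrow> complex^'d \<Rightarrow> complex) \<Rightarrow> bool" where
  "Comega_map_weight_system X I T w \<longleftrightarrow> Comega_map_system X I T \<and> Comega_weight_system X I w"


definition transfer_op ::
  "(complex^'d) set \<Rightarrow> 'i set \<Rightarrow> ('i \<Rightarrow> complex^'d \<Rightarrow> complex^'d) \<Rightarrow>
   ('i \<Rightarrow> complex^'d \<Rightarrow> complex) \<Rightarrow> (complex^'d \<Rightarrow> complex) \<Rightarrow> complex^'d \<Rightarrow> complex" where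
  "transfer_op D I T w f =
     (\<lambda>z. if z \<in> closure D then \<Sum>\<^sub>\<infinity>i\<in>I. w i z * f (T i z) else 0)"


definition fscale :: "complex \<Rightarrow> ('a \<Rightarrow> complex) \<Rightarrow> 'a \<Rightarrow> complex" where
  "fscale c f = (\<lambda>x. c * f x)"

interpretation cfun: vector_space "fscale :: complex \<Rightarrow> ('a \<Rightarrow> complex) \<Rightarrow> 'a \<Rightarrow> complex"
  by unfold_locales (auto simp: fscale_def fun_eq_iff algebra_simps)

definition gen_eigenspace ::
  "('a \<Rightarrow> complex) set \<Rightarrow> (('a \<Rightarrow> complex) \<Rightarrow> ('a \<Rightarrow> complex)) \<Rightarrow> complex \<Rightarrow> ('a \<Rightarrow> complex) set" where
  "gen_eigenspace V L \<mu> = {f\<in>V. \<exists>k. ((\<lambda>g. L g - fscale \<mu> g) ^^ k) f = 0}"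

definition alg_mult ::
  "('a \<Rightarrow> complex) set \<Rightarrow> (('a \<Rightarrow> complex) \<Rightarrow> ('a \<Rightarrow> complex)) \<Rightarrow> complex \<Rightarrow> nat" where
  "alg_mult V L \<mu> = cfun.dim (gen_eigenspace V L \<mu>)"

text \<open>
  For a compact operator \<open>L\<close> on \<open>V\<close>: \<open>ev 1, ev 2, \<dots>\<close> lists the non-zero eigenvalues with
  algebraic multiplicity in order of decreasing modulus. It is a relation because eigenvalues
  of equal modulus may come in any order; \<open>ev 0\<close> is unused. If there are infinitely many
  non-zero eigenvalues, monotonicity excludes zero entries; otherwise all
  entries after the last non-zero eigenvalue are forced to be zero.
\<close>

definition eigenvalue_sequence ::
  "('a \<Rightarrow> complex) set \<Rightarrow> (('a \<Rightarrow> complex) \<Rightarrow> ('a \<Rightarrow> complex)) \<Rightarrow> (nat \<Rightarrow> complex) \<Rightarrow> bool" where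
  "eigenvalue_sequence V L ev \<longleftrightarrow>
     (\<forall>m n. 1 \<le> m \<longrightarrow> m \<le> n \<longrightarrow> norm (ev n) \<le> norm (ev m)) \<and>
     (\<forall>\<mu>. \<mu> \<noteq> 0 \<longrightarrow> finite {n. 1 \<le> n \<and> ev n = \<mu>} \<and>
                     card {n. 1 \<le> n \<and> ev n = \<mu>} = alg_mult V L \<mu>)"

end

(* Let f_1, ..., f_n span an L-invariant subspace on which L is triangular with the first n
   eigenvalues on the diagonal, and put F(x_1, ..., x_n) = det (f_j (x_k)). Then
   det ((L f_j) (x_k)) = (lambda_1 ... lambda_n) F(x), while multilinearity in the columns exhibits
   the left-hand side as a weighted sum of values F(T_{i_1} x_1, ..., T_{i_n} x_n) of total weight
   at most W^n. The arguments lie in the ball of radius r R. In a basis adapted to the order of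
   vanishing at the centre, the k-th function vanishes to the degree of the k-th monomial (ordered
   by degree), so s |-> F(c + s (y - c)) vanishes at 0 to order S, the sum of the n lowest monomial
   degrees, and the Schwarz lemma gives |F| <= r^S sup |F| on the smaller ball. Hence
   |lambda_n|^n <= |lambda_1 ... lambda_n| <= W^n r^S, and S is estimated from below by comparing
   sum k^(1/d) with an integral. *)

theory Submission
  imports Defs "HOL-Complex_Analysis.Complex_Analysis" "Jordan_Normal_Form.Determinant"
begin

no_notation vec_index (infixl "$" 100)
no_notation fps_nth (infixl "$" 75)

section \<open>Difference quotients and the Schwarz lemma\<close>

text \<open>No single basis has to be triangular for the operator and graded by vanishing order at
  once: passing from one basis to the other multiplies both sides of the determinant identity by the
  same factor. The order of vanishing is handled without power series. Finitely many linear
  functionals, obtained by iterating restriction to a coordinate hyperplane and division by a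
  coordinate, force a growth bound \<open>C * norm x ^ m\<close>, and all that matters is how many
  of them there are. Dimension counting then produces the adapted basis. The constants come from
  \<open>((m + d) choose d) * d! <= (m + d)^d\<close>: the k-th monomial, counted from 1, has degree
  at least \<open>(d! * k)^(1/d) - d\<close>. Averaging the root over \<open>k\<close> yields the
  factor \<open>d / (d + 1)\<close>, and the subtracted \<open>d\<close> is the source of
  \<open>1 / r ^ d\<close>.\<close>

definition diff_quot :: "(complex \<Rightarrow> complex) \<Rightarrow> complex \<Rightarrow> complex" where
  "diff_quot g s = (if s = 0 then deriv g 0 else (g s - g 0) / s)"

lemma diff_quot_eq: "g s = g 0 + s * diff_quot g s"
  by (simp add: diff_quot_def)

lemma diff_quot_holomorphic:
  assumes "g holomorphic_on ball 0 \<rho>" "0 < \<rho>"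
  shows "diff_quot g holomorphic_on ball 0 \<rho>"
proof -
  have "diff_quot g = (\<lambda>z. if z = 0 then deriv g 0 else (g z - g 0) / (z - 0))"
    by (auto simp: diff_quot_def)
  moreover have "\<dots> holomorphic_on ball 0 \<rho>"
    by (rule pole_lemma) (use assms in auto)
  ultimately show ?thesis by simp
qed

text \<open>The Schwarz lemma is applied to \<open>g\<close> rescaled to the unit disc and divided
  by \<open>M' > M\<close>. The larger divisor makes the bound strict and is positive even for
  \<open>M = 0\<close>; \<open>M'\<close> then tends to \<open>M\<close>.\<close>

lemma diff_quot_norm_vanishing:
  assumes hol: "g holomorphic_on ball 0 \<rho>" and "0 < \<rho>" and g0: "g 0 = 0"
    and bound: "\<And>s. norm s < \<rho> \<Longrightarrow> norm (g s) \<le> M" and s: "norm s < \<rho>"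
  shows "norm (diff_quot g s) \<le> M / \<rho>"
proof -
  have M0: "0 \<le> M"
    using bound[of 0] \<open>0 < \<rho>\<close> order_trans[OF norm_ge_zero[of "g 0"]] by simp
  have less: "norm (diff_quot g s) \<le> M' / \<rho>" if "M < M'" for M'
  proof -
    define h where "h t = g (of_real \<rho> * t) / of_real M'" for t
    have "(\<lambda>t. g (of_real \<rho> * t)) holomorphic_on ball 0 1"
    proof (rule holomorphic_on_compose_gen[OF _ hol, unfolded o_def])
      show "(*) (complex_of_real \<rho>) ` ball 0 1 \<subseteq> ball 0 \<rho>"
        using \<open>0 < \<rho>\<close> by (auto simp: norm_mult)
    qed (intro holomorphic_intros)
    then have hh: "h holomorphic_on ball 0 1"
      unfolding h_def using that M0 by (intro holomorphic_intros) auto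
    have h0: "h 0 = 0" by (simp add: h_def g0)
    have h1: "norm (h t) < 1" if "norm t < 1" for t
    proof -
      have "norm (of_real \<rho> * t) < \<rho>" using that \<open>0 < \<rho>\<close> by (simp add: norm_mult)
      from bound[OF this] show ?thesis using \<open>M < M'\<close> M0 by (simp add: h_def norm_divide)
    qed
    show ?thesis
    proof (cases "s = 0")
      case True
      have gd: "g field_differentiable at (of_real \<rho> * 0)"
        using hol \<open>0 < \<rho>\<close> by (auto intro: holomorphic_on_imp_differentiable_at)
      have "((\<lambda>t. g (of_real \<rho> * t)) has_field_derivative (deriv g (of_real \<rho> * 0) * of_real \<rho>)) (at 0)"
        by (rule DERIV_chain2[of g]) (use gd in \<open>auto intro!: derivative_eq_intros simp: DERIV_deriv_iff_field_differentiable\<close>)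
      then have "(h has_field_derivative (deriv g (of_real \<rho> * 0) * of_real \<rho>) / of_real M') (at 0)"
        unfolding h_def by (rule DERIV_cdivide)
      then have dh: "deriv h 0 = deriv g 0 * of_real \<rho> / of_real M'"
        by (simp add: DERIV_imp_deriv)
      have "norm (deriv h 0) \<le> 1"
        using Schwarz_Lemma(2)[OF hh h0 h1, of 0] by simp
      then have "norm (deriv g 0) * \<rho> / M' \<le> 1"
        unfolding dh using \<open>0 < \<rho>\<close> \<open>M < M'\<close> M0 by (simp add: norm_mult norm_divide)
      then show ?thesis using True \<open>0 < \<rho>\<close> \<open>M < M'\<close> M0
        by (simp add: diff_quot_def field_simps)
    next
      case False
      have ns: "norm (s / of_real \<rho>) < 1" using s \<open>0 < \<rho>\<close> by (simp add: norm_divide)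
      have "norm (h (s / of_real \<rho>)) \<le> norm (s / of_real \<rho>)"
        by (rule Schwarz_Lemma(1)[OF hh h0 h1 ns])
      then have "norm (g s) / M' \<le> norm s / \<rho>"
        using \<open>0 < \<rho>\<close> \<open>M < M'\<close> M0 by (simp add: h_def norm_divide)
      then show ?thesis using False \<open>0 < \<rho>\<close> \<open>M < M'\<close> M0
        by (simp add: diff_quot_def norm_divide g0 field_simps)
    qed
  qed
  show ?thesis
  proof (rule field_le_epsilon)
    fix e :: real assume "0 < e"
    with less[of "M + e * \<rho>"] \<open>0 < \<rho>\<close> show "norm (diff_quot g s) \<le> M / \<rho> + e"
      by (simp add: field_simps)
  qed
qed

lemma diff_quot_norm:
  assumes hol: "g holomorphic_on ball 0 \<rho>" and "0 < \<rho>"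
    and bound: "\<And>s. norm s < \<rho> \<Longrightarrow> norm (g s) \<le> M" and s: "norm s < \<rho>"
  shows "norm (diff_quot g s) \<le> 2 * M / \<rho>"
proof -
  have gd: "g field_differentiable at 0"
    using hol \<open>0 < \<rho>\<close> by (auto intro: holomorphic_on_imp_differentiable_at)
  have "diff_quot g s = diff_quot (\<lambda>t. g t - g 0) s"
    by (auto simp: diff_quot_def deriv_diff gd)
  also have "norm \<dots> \<le> (2 * M) / \<rho>"
  proof (rule diff_quot_norm_vanishing)
    fix t :: complex assume "norm t < \<rho>"
    then show "norm (g t - g 0) \<le> 2 * M"
      using norm_triangle_ineq4[of "g t" "g 0"] bound[of t] bound[of 0] \<open>0 < \<rho>\<close> by auto
  qed (use assms in \<open>auto intro!: holomorphic_intros\<close>)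
  finally show ?thesis .
qed

text \<open>The remainder is \<open>s^2\<close> times an iterated difference quotient, and each of
  the two quotients costs a factor \<open>2 / \<rho>\<close>. The bound depends on \<open>g\<close>
  through \<open>M\<close> alone, so it can be summed over a family of functions.\<close>

lemma holomorphic_first_order_remainder:
  assumes hol: "g holomorphic_on ball 0 \<rho>" and "0 < \<rho>"
    and bound: "\<And>s. norm s < \<rho> \<Longrightarrow> norm (g s) \<le> M" and s: "norm s < \<rho>"
  shows "norm (g s - g 0 - s * deriv g 0) \<le> 4 * M / \<rho>\<^sup>2 * (norm s)\<^sup>2"
proof -
  let ?h = "diff_quot g"
  have "g s - g 0 - s * deriv g 0 = s * (s * diff_quot ?h s)"
    using diff_quot_eq[of g s] diff_quot_eq[of ?h s]
    by (simp add: diff_quot_def[of g 0] algebra_simps)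
  moreover have "norm (diff_quot ?h s) \<le> 2 * (2 * M / \<rho>) / \<rho>"
    by (rule diff_quot_norm[OF diff_quot_holomorphic[OF hol]])
       (use assms diff_quot_norm[OF hol] in auto)
  ultimately show ?thesis
    using mult_left_mono[of "norm (diff_quot ?h s)" _ "norm s * norm s"]
    by (fastforce simp: norm_mult power2_eq_square mult_ac)
qed

text \<open>Dividing by \<open>s\<close> lowers the order by one and, because the disc has radius 1,
  does not enlarge the bound \<open>M\<close>. The constant \<open>C\<close> only records the order
  of the zero; it drops out of the conclusion.\<close>

lemma Schwarz_higher_order:
  assumes "h holomorphic_on ball 0 1" "\<And>s. norm s < 1 \<Longrightarrow> norm (h s) \<le> M"
    and "\<And>s. norm s < 1 \<Longrightarrow> norm (h s) \<le> C * norm s ^ S" and "norm s < 1"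
  shows "norm (h s) \<le> M * norm s ^ S"
  using assms
proof (induction S arbitrary: h C)
  case 0
  then show ?case by simp
next
  case (Suc S)
  have h0: "h 0 = 0" using Suc.prems(3)[of 0] by simp
  have M: "norm (diff_quot h s) \<le> M" if "norm s < 1" for s
    using diff_quot_norm_vanishing[of h 1 M s] h0 Suc.prems that by simp
  have Cs: "norm (diff_quot h s) \<le> C * norm s ^ S" if s: "norm s < 1" "s \<noteq> 0" for s
    using Suc.prems(3)[OF s(1)] s(2) h0
    by (simp add: diff_quot_def norm_divide field_simps)
  have hol: "diff_quot h holomorphic_on ball 0 1"
    by (rule diff_quot_holomorphic) (use Suc.prems in auto)
  \<comment> \<open>Division says nothing at \<open>0\<close> itself, where the bound follows by
    continuity; for \<open>S = 0\<close> it reads \<open>norm (diff_quot h 0) \<le> C\<close>, as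
    \<open>0 ^ 0 = 1\<close>.\<close>
  have C0': "norm (diff_quot h 0) \<le> C * norm (0::complex) ^ S"
  proof (rule tendsto_le)
    show "((\<lambda>s. norm (diff_quot h s)) \<longlongrightarrow> norm (diff_quot h 0)) (at 0)"
      using holomorphic_on_imp_continuous_on[OF hol]
      by (intro tendsto_norm) (auto simp: continuous_on_eq_continuous_at isCont_def)
    show "((\<lambda>s::complex. C * norm s ^ S) \<longlongrightarrow> C * norm (0::complex) ^ S) (at 0)"
      by (rule isContD[of 0 "\<lambda>s::complex. C * norm s ^ S"]) (intro continuous_intros)
    show "\<forall>\<^sub>F s in at 0. norm (diff_quot h s) \<le> C * norm s ^ S"
      unfolding eventually_at by (rule exI[of _ 1]) (use Cs in auto)
  qed auto
  have "norm (diff_quot h s) \<le> M * norm s ^ S"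
  proof (rule Suc.IH[OF hol M])
    fix t :: complex assume "norm t < 1"
    then show "norm (diff_quot h t) \<le> C * norm t ^ S"
      using Cs C0' by (cases "t = 0") auto
  qed (use Suc.prems in auto)
  then have "norm s * norm (diff_quot h s) \<le> norm s * (M * norm s ^ S)"
    by (intro mult_left_mono) auto
  then show ?case
    using diff_quot_eq[of h s] h0 by (simp add: norm_mult mult_ac)
qed

section \<open>Order of vanishing in several variables\<close>

definition upd :: "complex^'d \<Rightarrow> 'd \<Rightarrow> complex \<Rightarrow> complex^'d" where
  "upd x j s = (\<chi> i. if i = j then s else x $ i)"

lemma upd_simps [simp]:
  "upd x j s $ j = s" "i \<noteq> j \<Longrightarrow> upd x j s $ i = x $ i"
  "upd (upd x j s) j t = upd x j t" "upd x j (x $ j) = x"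
  by (simp_all add: upd_def Finite_Cartesian_Product.vec_eq_iff)

lemma upd_commute: "i \<noteq> j \<Longrightarrow> upd (upd x i s) j t = upd (upd x j t) i s"
  by (auto simp: upd_def Finite_Cartesian_Product.vec_eq_iff)

text \<open>A product domain, so that one coordinate can be replaced by any number of modulus below
  \<open>\<rho>\<close> whatever the others are; a Euclidean ball does not allow this.\<close>

definition polydisc :: "real \<Rightarrow> (complex^'d) set" where
  "polydisc \<rho> = {x. \<forall>i. norm (x $ i) < \<rho>}"

lemma upd_polydisc: "x \<in> polydisc \<rho> \<Longrightarrow> norm s < \<rho> \<Longrightarrow> upd x j s \<in> polydisc \<rho>"
  by (auto simp: polydisc_def upd_def)

text \<open>Boundedness together with holomorphy in each variable separately is stable under
  restriction and division by a coordinate, which is all that the recursion on the order requires.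
  Boundedness enters in the division: it makes difference quotients converge uniformly.\<close>

definition sep_holo :: "real \<Rightarrow> (complex^'d \<Rightarrow> complex) set" where
  "sep_holo \<rho> = {f. (\<exists>M. \<forall>x\<in>polydisc \<rho>. norm (f x) \<le> M) \<and>
     (\<forall>x\<in>polydisc \<rho>. \<forall>j. (\<lambda>s. f (upd x j s)) holomorphic_on ball 0 \<rho>)}"

definition vres :: "'d \<Rightarrow> (complex^'d \<Rightarrow> complex) \<Rightarrow> complex^'d \<Rightarrow> complex" where
  "vres j f x = f (upd x j 0)"

text \<open>
  \<open>f = vres j f + x\<^sub>j * vdiv \<rho> j f\<close> on the polydisc; the value \<open>0\<close> elsewhere makes
  \<open>vdiv\<close> linear on \<open>sep_holo \<rho>\<close> as an operation on total functions.
\<close>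

definition vdiv :: "real \<Rightarrow> 'd \<Rightarrow> (complex^'d \<Rightarrow> complex) \<Rightarrow> complex^'d \<Rightarrow> complex" where
  "vdiv \<rho> j f x = (if x \<in> polydisc \<rho> then diff_quot (\<lambda>s. f (upd x j s)) (x $ j) else 0)"

lemma sep_holo_norm_bound:
  assumes "f \<in> sep_holo \<rho>"
  obtains M where "0 \<le> M" "\<And>x. x \<in> polydisc \<rho> \<Longrightarrow> norm (f x) \<le> M"
proof -
  from assms obtain M where "\<And>x. x \<in> polydisc \<rho> \<Longrightarrow> norm (f x) \<le> M"
    by (auto simp: sep_holo_def)
  then have "\<And>x. x \<in> polydisc \<rho> \<Longrightarrow> norm (f x) \<le> max 0 M" by fastforce
  then show ?thesis using that[of "max 0 M"] by simp
qed

lemma sep_holoD: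
  "f \<in> sep_holo \<rho> \<Longrightarrow> x \<in> polydisc \<rho> \<Longrightarrow> (\<lambda>s. f (upd x j s)) holomorphic_on ball 0 \<rho>"
  by (auto simp: sep_holo_def)

lemma vres_sep_holo:
  assumes "0 < \<rho>" and f: "f \<in> sep_holo \<rho>"
  shows "vres j f \<in> sep_holo \<rho>"
proof -
  obtain M where "\<And>x. x \<in> polydisc \<rho> \<Longrightarrow> norm (f x) \<le> M"
    using sep_holo_norm_bound[OF f] by blast
  then have "\<forall>x\<in>polydisc \<rho>. norm (vres j f x) \<le> M"
    by (auto simp: vres_def upd_polydisc \<open>0 < \<rho>\<close>)
  moreover have "(\<lambda>s. vres j f (upd x i s)) holomorphic_on ball 0 \<rho>" if "x \<in> polydisc \<rho>" for x i
  proof (cases "i = j")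
    case False
    then show ?thesis
      using sep_holoD[OF f upd_polydisc[OF that, of 0 j], of i] \<open>0 < \<rho>\<close>
      by (simp add: vres_def upd_commute)
  qed (simp add: vres_def)
  ultimately show ?thesis by (auto simp: sep_holo_def)
qed

text \<open>The critical case is holomorphy in \<open>x_i\<close> at points with
  \<open>x_j = 0\<close> and \<open>i \<noteq> j\<close>, where \<open>vdiv\<close> is the partial
  derivative in \<open>x_j\<close>. It is a uniform limit of difference quotients, which are
  holomorphic in \<open>x_i\<close>.\<close>

lemma vdiv_sep_holo:
  assumes "0 < \<rho>" and f: "f \<in> sep_holo \<rho>"
  shows "vdiv \<rho> j f \<in> sep_holo \<rho>"
proof -
  obtain M where M0: "0 \<le> M" and M: "\<And>x. x \<in> polydisc \<rho> \<Longrightarrow> norm (f x) \<le> M"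
    using sep_holo_norm_bound[OF f] by blast
  let ?g = "\<lambda>x s. f (upd x j s)"
  have dq: "norm (diff_quot (?g x) s) \<le> 2 * M / \<rho>" if "x \<in> polydisc \<rho>" "norm s < \<rho>" for x s
    by (rule diff_quot_norm[OF sep_holoD[OF f]])
       (use that \<open>0 < \<rho>\<close> in \<open>auto intro!: M upd_polydisc\<close>)
  have "\<forall>x\<in>polydisc \<rho>. norm (vdiv \<rho> j f x) \<le> 2 * M / \<rho>"
    using dq by (auto simp: vdiv_def) (auto simp: polydisc_def)
  moreover have "(\<lambda>s. vdiv \<rho> j f (upd x i s)) holomorphic_on ball 0 \<rho>"
    if x: "x \<in> polydisc \<rho>" for x i
  proof (cases "i = j")
    case True
    have "diff_quot (?g x) holomorphic_on ball 0 \<rho>"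
      by (intro diff_quot_holomorphic sep_holoD[OF f x] \<open>0 < \<rho>\<close>)
    then show ?thesis
      by (rule holomorphic_transform) (use x True in \<open>auto simp: vdiv_def upd_polydisc\<close>)
  next
    case False
    define G where "G t s = diff_quot (?g (upd x i s)) t" for t s
    have G: "G t holomorphic_on ball 0 \<rho>" if "t \<noteq> 0" "norm t < \<rho>" for t
    proof -
      have "(\<lambda>s. (f (upd (upd x j t) i s) - f (upd (upd x j 0) i s)) / t) holomorphic_on ball 0 \<rho>"
        by (intro holomorphic_intros sep_holoD[OF f] upd_polydisc x) (use that \<open>0 < \<rho>\<close> in auto)
      then show ?thesis
        by (rule holomorphic_transform)
           (use that False in \<open>auto simp: G_def diff_quot_def upd_commute\<close>)
    qed
    have "G (x $ j) holomorphic_on ball 0 \<rho>"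
    proof (cases "x $ j = 0")
      case True
      \<comment> \<open>Any null sequence of non-zero numbers of modulus below \<open>\<rho>\<close>
        would do; the \<open>+ 2\<close> gives the strict bound already for
        \<open>n = 0\<close>.\<close>
      define t where "t n = complex_of_real (\<rho> / (real n + 2))" for n
      have t: "t n \<noteq> 0" "norm (t n) < \<rho>" for n
      proof -
        show "t n \<noteq> 0" using \<open>0 < \<rho>\<close> by (simp add: t_def complex_eq_iff)
        have "\<rho> / (real n + 2) < \<rho>" using \<open>0 < \<rho>\<close> by (simp add: divide_less_eq algebra_simps add_pos_nonneg)
        then show "norm (t n) < \<rho>" unfolding t_def norm_of_real using \<open>0 < \<rho>\<close> by simp
      qed
      have tlim: "t \<longlonglongrightarrow> 0"
      proof -
        have "(\<lambda>n. \<rho> / (real n + 2)) \<longlonglongrightarrow> 0"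
          using tendsto_mult_right_zero[OF LIMSEQ_ignore_initial_segment[OF lim_inverse_n, of 2], of \<rho>]
          by (simp add: divide_inverse add.commute)
        then show ?thesis unfolding t_def by (metis of_real_0 tendsto_of_real)
      qed
      \<comment> \<open>The difference is \<open>t n\<close> times a second-order difference
        quotient, which is bounded independently of \<open>s\<close>; hence the convergence is
        uniform.\<close>
      have Gdiff: "dist (G (t n) s) (G 0 s) \<le> norm (t n) * (4 * M / \<rho>\<^sup>2)"
        if "s \<in> ball 0 \<rho>" for n s
      proof -
        have p: "upd x i s \<in> polydisc \<rho>" using that x by (simp add: upd_polydisc)
        have "norm (diff_quot (diff_quot (?g (upd x i s))) (t n)) \<le> 2 * (2 * M / \<rho>) / \<rho>"
          by (rule diff_quot_norm[OF diff_quot_holomorphic[OF sep_holoD[OF f p]]])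
             (use \<open>0 < \<rho>\<close> t dq[OF p] in auto)
        moreover have "G (t n) s - G 0 s = t n * diff_quot (diff_quot (?g (upd x i s))) (t n)"
          using diff_quot_eq[of "diff_quot (?g (upd x i s))" "t n"] by (simp add: G_def)
        moreover have "2 * (2 * M / \<rho>) / \<rho> = 4 * M / \<rho>\<^sup>2"
          by (simp add: power2_eq_square)
        ultimately show ?thesis
          unfolding dist_norm by (metis mult_left_mono norm_ge_zero norm_mult)
      qed
      have lim: "(\<lambda>n. norm (t n) * (4 * M / \<rho>\<^sup>2)) \<longlonglongrightarrow> 0"
        using tendsto_mult_right[OF tendsto_norm[OF tlim], of "4 * M / \<rho>\<^sup>2"] by simp
      have ul: "uniform_limit (ball 0 \<rho>) (\<lambda>n. G (t n)) (G 0) sequentially"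
      proof (rule uniform_limitI)
        fix e :: real assume "0 < e"
        from order_tendstoD(2)[OF lim this]
        show "\<forall>\<^sub>F n in sequentially. \<forall>s\<in>ball 0 \<rho>. dist (G (t n) s) (G 0 s) < e"
          by eventually_elim (use Gdiff in \<open>blast intro: le_less_trans\<close>)
      qed
      have "G 0 holomorphic_on ball 0 \<rho>"
      proof (rule holomorphic_uniform_sequence[of _ "\<lambda>n. G (t n)"])
        fix z :: complex assume "z \<in> ball 0 \<rho>"
        then obtain e where "0 < e" "cball z e \<subseteq> ball 0 \<rho>"
          by (meson open_ball open_contains_cball)
        then show "\<exists>e>0. cball z e \<subseteq> ball 0 \<rho> \<and> uniform_limit (cball z e) (\<lambda>n. G (t n)) (G 0) sequentially"
          using uniform_limit_on_subset[OF ul] by blast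
      qed (use G t in auto)
      then show ?thesis using True by simp
    qed (use G x in \<open>auto simp: polydisc_def\<close>)
    then show ?thesis
      by (rule holomorphic_transform) (use x False in \<open>auto simp: vdiv_def upd_polydisc G_def\<close>)
  qed
  ultimately show ?thesis by (auto simp: sep_holo_def)
qed

lemma vres_vdiv_eq:
  assumes "x \<in> polydisc \<rho>"
  shows "f x = vres j f x + x $ j * vdiv \<rho> j f x"
  using diff_quot_eq[of "\<lambda>s. f (upd x j s)" "x $ j"] assms by (simp add: vres_def vdiv_def)

text \<open>Linearity is relative to \<open>V\<close> because functionals built from
  \<open>vdiv\<close> involve derivatives, which are additive only for differentiable
  functions.\<close>

definition linear_functional_on ::
  "('a \<Rightarrow> complex) set \<Rightarrow> (('a \<Rightarrow> complex) \<Rightarrow> complex) \<Rightarrow> bool" where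
  "linear_functional_on V \<phi> \<longleftrightarrow> (\<forall>f\<in>V. \<forall>g\<in>V. \<forall>a. \<phi> (\<lambda>x. a * f x + g x) = a * \<phi> f + \<phi> g)"

lemma vres_linear: "vres j (\<lambda>x. a * f x + g x) = (\<lambda>x. a * vres j f x + vres j g x)"
  by (simp add: vres_def fun_eq_iff)

lemma vdiv_linear:
  assumes "0 < \<rho>" "f \<in> sep_holo \<rho>" "g \<in> sep_holo \<rho>"
  shows "vdiv \<rho> j (\<lambda>x. a * f x + g x) = (\<lambda>x. a * vdiv \<rho> j f x + vdiv \<rho> j g x)"
proof
  fix x
  show "vdiv \<rho> j (\<lambda>x. a * f x + g x) x = a * vdiv \<rho> j f x + vdiv \<rho> j g x"
  proof (cases "x \<in> polydisc \<rho>")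
    case True
    have d: "(\<lambda>s. h (upd x j s)) field_differentiable at 0" if "h \<in> sep_holo \<rho>" for h
      using sep_holoD[OF that True, of j] \<open>0 < \<rho>\<close>
      by (auto intro: holomorphic_on_imp_differentiable_at)
    have "deriv (\<lambda>s. a * f (upd x j s) + g (upd x j s)) 0 =
        a * deriv (\<lambda>s. f (upd x j s)) 0 + deriv (\<lambda>s. g (upd x j s)) 0"
      by (subst deriv_add) (use d assms in \<open>auto intro!: derivative_intros\<close>)
    then show ?thesis using True by (simp add: vdiv_def diff_quot_def field_simps)
  qed (simp add: vdiv_def)
qed

text \<open>The dimension is fixed by the type, so the induction on the number of variables runs
  over the set \<open>J\<close> of variables that may occur. Independence of the others is tested
  only against the value \<open>0\<close> of that coordinate.\<close>

definition depends_on :: "real \<Rightarrow> 'd set \<Rightarrow> (complex^'d \<Rightarrow> complex) set" where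
  "depends_on \<rho> J = {f. \<forall>j. j \<notin> J \<longrightarrow> (\<forall>x\<in>polydisc \<rho>. f (upd x j 0) = f x)}"

lemma depends_onD: "f \<in> depends_on \<rho> J \<Longrightarrow> j \<notin> J \<Longrightarrow> x \<in> polydisc \<rho> \<Longrightarrow> f (upd x j 0) = f x"
  by (auto simp: depends_on_def)

lemma vres_depends_on:
  fixes J :: "'d::finite set"
  assumes "0 < \<rho>" "f \<in> depends_on \<rho> (insert j J)"
  shows "vres j f \<in> depends_on \<rho> J"
  unfolding depends_on_def
proof (clarsimp simp: vres_def)
  fix i and x :: "complex^'d" assume "i \<notin> J" and x: "x \<in> polydisc \<rho>"
  then show "f (upd (upd x i 0) j 0) = f (upd x j 0)"
    using depends_onD[OF assms(2), of i "upd x j 0"] upd_polydisc[OF x, of 0 j] assms(1)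
    by (cases "i = j") (auto simp: upd_commute)
qed

lemma vdiv_depends_on:
  fixes J :: "'d::finite set"
  assumes "0 < \<rho>" "f \<in> depends_on \<rho> J" "j \<in> J"
  shows "vdiv \<rho> j f \<in> depends_on \<rho> J"
  unfolding depends_on_def
proof clarsimp
  fix i and x :: "complex^'d" assume "i \<notin> J" and x: "x \<in> polydisc \<rho>"
  then have ij: "i \<noteq> j" using assms by auto
  have *: "f (upd (upd x i 0) j s) = f (upd x j s)" if "norm s < \<rho>" for s
    using depends_onD[OF assms(2) \<open>i \<notin> J\<close>, of "upd x j s"] upd_polydisc[OF x that] ij
    by (simp add: upd_commute)
  \<comment> \<open>At \<open>x $ j = 0\<close> the quotient is a derivative, so the two slices must
    agree on a neighbourhood of \<open>0\<close>.\<close>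
  have "eventually (\<lambda>s. f (upd (upd x i 0) j s) = f (upd x j s)) (nhds 0)"
    using eventually_nhds_in_open[of "ball 0 \<rho>" "0::complex"] \<open>0 < \<rho>\<close>
    by (auto elim!: eventually_mono simp: *)
  then have "deriv (\<lambda>s. f (upd (upd x i 0) j s)) 0 = deriv (\<lambda>s. f (upd x j s)) 0"
    by (rule deriv_cong_ev) simp
  moreover have "norm (x $ j) < \<rho>" using x by (simp add: polydisc_def)
  moreover have "upd x i 0 \<in> polydisc \<rho>" using upd_polydisc[OF x] assms(1) by simp
  ultimately show "vdiv \<rho> j f (upd x i 0) = vdiv \<rho> j f x"
    using x ij * assms(1) *[of "x $ j"] by (simp add: vdiv_def diff_quot_def)
qed

text \<open>A growth bound in place of Taylor coefficients: such bounds multiply in the terms of a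
  determinant, and they are the form of input that \<open>Schwarz_higher_order\<close>
  takes.\<close>

definition vanishes_to :: "real \<Rightarrow> nat \<Rightarrow> (complex^'d \<Rightarrow> complex) \<Rightarrow> bool" where
  "vanishes_to \<rho> m f \<longleftrightarrow> (\<exists>C\<ge>0. \<forall>x\<in>polydisc \<rho>. norm (f x) \<le> C * norm x ^ m)"

text \<open>The functionals constructed below are in effect Taylor coefficients of degree less than
  \<open>m\<close>, but all that is used is how many of them suffice to force the order.\<close>

definition vanishing_functionals ::
  "real \<Rightarrow> 'd set \<Rightarrow> nat \<Rightarrow> ((complex^'d \<Rightarrow> complex) \<Rightarrow> complex) set \<Rightarrow> bool" where
  "vanishing_functionals \<rho> J m S \<longleftrightarrow> finite S \<and>
     (\<forall>\<phi>\<in>S. linear_functional_on (sep_holo \<rho>) \<phi>) \<and>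
     (\<forall>f\<in>sep_holo \<rho> \<inter> depends_on \<rho> J. (\<forall>\<phi>\<in>S. \<phi> f = 0) \<longrightarrow> vanishes_to \<rho> m f)"

lemma vanishing_functionalsD:
  "vanishing_functionals \<rho> J m S \<Longrightarrow> f \<in> sep_holo \<rho> \<inter> depends_on \<rho> J \<Longrightarrow> \<forall>\<phi>\<in>S. \<phi> f = 0 \<Longrightarrow>
    vanishes_to \<rho> m f"
  by (simp add: vanishing_functionals_def)

lemma vanishing_functionals_empty:
  assumes "0 < \<rho>"
  shows "vanishing_functionals \<rho> {} m {\<lambda>f. f 0}"
  unfolding vanishing_functionals_def
proof (intro conjI ballI impI)
  fix f :: "complex^'d \<Rightarrow> complex"
  assume f: "f \<in> sep_holo \<rho> \<inter> depends_on \<rho> {}" and "\<forall>\<phi>\<in>{\<lambda>f. f 0}. \<phi> f = 0"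
  then have f0: "f 0 = 0" by simp
  \<comment> \<open>Coordinates are set to \<open>0\<close> one at a time; \<open>A\<close> is the
    set of those already replaced, and \<open>A = UNIV\<close> shows that \<open>f\<close> is
    constant on the polydisc.\<close>
  have "f (\<chi> i. if i \<in> A then 0 else x $ i) = f x" if x: "x \<in> polydisc \<rho>" for A x
  proof -
    have "finite A" by simp
    then show ?thesis
    proof (induction A rule: finite_induct)
      case empty
      have "(\<chi> i. x $ i) = x" by (simp add: Finite_Cartesian_Product.vec_eq_iff)
      then show ?case by simp
    next
      case (insert j A)
      let ?y = "\<chi> i. if i \<in> A then 0 else x $ i"
      have "?y \<in> polydisc \<rho>" using x assms by (auto simp: polydisc_def)
      then have "f (upd ?y j 0) = f ?y" using f by (auto simp: depends_on_def)
      moreover have "upd ?y j 0 = (\<chi> i. if i \<in> insert j A then 0 else x $ i)"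
        by (auto simp: upd_def Finite_Cartesian_Product.vec_eq_iff)
      ultimately show ?case using insert.IH by simp
    qed
  qed
  from this[of _ UNIV] have "f x = f 0" if "x \<in> polydisc \<rho>" for x
    using that by (simp add: Finite_Cartesian_Product.zero_vec_def)
  with f0 show "vanishes_to \<rho> m f"
    unfolding vanishes_to_def by (intro exI[of _ 0]) simp
qed (simp_all add: linear_functional_on_def)

lemma vanishing_functionals_0:
  fixes J :: "'d::finite set"
  shows "vanishing_functionals \<rho> J 0 {}"
  unfolding vanishing_functionals_def
proof (intro conjI ballI impI)
  fix f :: "complex^'d \<Rightarrow> complex" assume "f \<in> sep_holo \<rho> \<inter> depends_on \<rho> J"
  then have "f \<in> sep_holo \<rho>" by simp
  then obtain M where "0 \<le> M" "\<And>x. x \<in> polydisc \<rho> \<Longrightarrow> norm (f x) \<le> M"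
    by (rule sep_holo_norm_bound) (rule that)
  then show "vanishes_to \<rho> 0 f"
    unfolding vanishes_to_def by (intro exI[of _ M]) simp
qed simp_all

text \<open>In \<open>f = vres j f + x_j * vdiv \<rho> j f\<close> the first term no longer involves
  the variable \<open>j\<close>, and the second gains one order from the factor \<open>x_j\<close>,
  so order \<open>m\<close> suffices for the quotient.\<close>

lemma vanishing_functionals_insert:
  assumes "0 < \<rho>"
    and S1: "vanishing_functionals \<rho> J (Suc m) S1"
    and S2: "vanishing_functionals \<rho> (insert j J) m S2"
  shows "vanishing_functionals \<rho> (insert j J) (Suc m)
    ((\<lambda>\<phi> f. \<phi> (vres j f)) ` S1 \<union> (\<lambda>\<phi> f. \<phi> (vdiv \<rho> j f)) ` S2)" (is "vanishing_functionals _ _ _ ?S")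
  unfolding vanishing_functionals_def
proof (intro conjI ballI impI)
  show "finite ?S" using S1 S2 by (simp add: vanishing_functionals_def)
  fix \<phi> assume "\<phi> \<in> ?S"
  then consider \<psi> where "\<psi> \<in> S1" "\<phi> = (\<lambda>f. \<psi> (vres j f))"
    | \<psi> where "\<psi> \<in> S2" "\<phi> = (\<lambda>f. \<psi> (vdiv \<rho> j f))" by blast
  then show "linear_functional_on (sep_holo \<rho>) \<phi>"
  proof cases
    case 1
    then have "linear_functional_on (sep_holo \<rho>) \<psi>"
      using S1 by (simp add: vanishing_functionals_def)
    then show ?thesis
      by (simp add: 1 linear_functional_on_def vres_linear vres_sep_holo[OF assms(1)])
  next
    case 2
    then have "linear_functional_on (sep_holo \<rho>) \<psi>"
      using S2 by (simp add: vanishing_functionals_def)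
    then show ?thesis
      by (simp add: 2 linear_functional_on_def vdiv_linear[OF assms(1)] vdiv_sep_holo[OF assms(1)])
  qed
next
  fix f assume f: "f \<in> sep_holo \<rho> \<inter> depends_on \<rho> (insert j J)" and z: "\<forall>\<phi>\<in>?S. \<phi> f = 0"
  have "vres j f \<in> sep_holo \<rho> \<inter> depends_on \<rho> J"
    using f vres_sep_holo[OF assms(1), of f j] vres_depends_on[OF assms(1), of f j J] by simp
  then have "vanishes_to \<rho> (Suc m) (vres j f)"
    by (rule vanishing_functionalsD[OF S1]) (use z in \<open>simp add: ball_Un\<close>)
  then obtain C1 where C1: "C1 \<ge> 0" "\<forall>x\<in>polydisc \<rho>. norm (vres j f x) \<le> C1 * norm x ^ Suc m"
    unfolding vanishes_to_def by blast
  have "vdiv \<rho> j f \<in> sep_holo \<rho> \<inter> depends_on \<rho> (insert j J)"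
    using f vdiv_sep_holo[OF assms(1), of f j] vdiv_depends_on[OF assms(1), of f "insert j J" j] by simp
  then have "vanishes_to \<rho> m (vdiv \<rho> j f)"
    by (rule vanishing_functionalsD[OF S2]) (use z in \<open>simp add: ball_Un\<close>)
  then obtain C2 where C2: "C2 \<ge> 0" "\<forall>x\<in>polydisc \<rho>. norm (vdiv \<rho> j f x) \<le> C2 * norm x ^ m"
    unfolding vanishes_to_def by blast
  have "norm (f x) \<le> (C1 + C2) * norm x ^ Suc m" if x: "x \<in> polydisc \<rho>" for x
  proof -
    have "norm (f x) \<le> norm (vres j f x) + norm (x $ j) * norm (vdiv \<rho> j f x)"
      by (subst vres_vdiv_eq[OF x, of f j]) (metis norm_mult norm_triangle_ineq)
    also have "\<dots> \<le> C1 * norm x ^ Suc m + norm x * (C2 * norm x ^ m)"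
      using bspec[OF C1(2) x] bspec[OF C2(2) x] C2(1) Finite_Cartesian_Product.norm_nth_le[of x j]
      by (intro add_mono mult_mono) simp_all
    finally show ?thesis by (simp add: algebra_simps)
  qed
  then show "vanishes_to \<rho> (Suc m) f"
    using C1(1) C2(1) unfolding vanishes_to_def by (intro exI[of _ "C1 + C2"]) simp
qed

text \<open>
  The bound is the number of monomials of degree less than \<open>m\<close> in the variables \<open>J\<close>. Splitting
  off one variable turns the recursion into Pascal's rule.
\<close>

lemma ex_vanishing_functionals:
  fixes J :: "'d::finite set"
  assumes "0 < \<rho>"
  shows "\<exists>S. vanishing_functionals \<rho> J m S \<and> card S \<le> (card J + m - 1) choose card J"
proof -
  have "finite J" by simp
  then show ?thesis
  proof (induction J arbitrary: m rule: finite_induct)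
    case empty
    show ?case
      by (rule exI[of _ "{\<lambda>f. f 0}"]) (simp add: vanishing_functionals_empty[OF assms])
  next
    case (insert j J)
    show ?case
    proof (induction m)
      \<comment> \<open>The set of variables is non-empty here, so the binomial coefficient has the
        form \<open>n - 1 choose n = 0\<close>: no functional is allowed, and none is required for
        order \<open>0\<close>.\<close>
      case 0
      show ?case
        by (rule exI[of _ "{}"]) (simp add: vanishing_functionals_0)
    next
      case (Suc m)
      from insert.IH[of "Suc m"] obtain S1 where S1: "vanishing_functionals \<rho> J (Suc m) S1"
        "card S1 \<le> (card J + Suc m - 1) choose card J" by (elim exE conjE)
      from Suc.IH obtain S2 where S2: "vanishing_functionals \<rho> (insert j J) m S2"
        "card S2 \<le> (card (insert j J) + m - 1) choose card (insert j J)" by (elim exE conjE)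
      let ?S = "(\<lambda>\<phi> f. \<phi> (vres j f)) ` S1 \<union> (\<lambda>\<phi> f. \<phi> (vdiv \<rho> j f)) ` S2"
      have "finite S1" "finite S2" using S1 S2 by (simp_all add: vanishing_functionals_def)
      then have "card ?S \<le> card S1 + card S2"
        by (intro order_trans[OF card_Un_le] add_mono card_image_le)
      also have "\<dots> \<le> (card J + m choose card J) + (card J + m choose Suc (card J))"
        using S1(2) S2(2) insert.hyps by simp
      finally have "card ?S \<le> card (insert j J) + Suc m - 1 choose card (insert j J)"
        using insert.hyps by simp
      then show ?case
        using vanishing_functionals_insert[OF assms S1(1) S2(1)] by (intro exI conjI)
    qed
  qed
qed

section \<open>Triangular bases of generalized eigenspaces\<close>

lemma linear_functional_onD:
  assumes "linear_functional_on V \<phi>" "f \<in> V" "g \<in> V"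
  shows "\<phi> (fscale a f + g) = a * \<phi> f + \<phi> g"
  using assms by (simp add: linear_functional_on_def fscale_def plus_fun_def)

text \<open>This is a dimension count: the joint kernel of \<open>S\<close> in the span of
  \<open>B\<close> has dimension at least \<open>card B - card S\<close>, which exceeds
  \<open>card G\<close>. The induction combines two candidates so as to kill one more functional;
  the second is taken outside the span of \<open>insert v G\<close>, which keeps the combination
  outside the span of \<open>G\<close>.\<close>

lemma ex_span_kernel_not_in_span:
  assumes "finite S" "\<forall>\<phi>\<in>S. linear_functional_on V \<phi>" and V: "cfun.subspace V" "B \<subseteq> V"
    and B: "cfun.independent B" and "finite G" "card S + card G < card B"
  shows "\<exists>v\<in>cfun.span B - cfun.span G. \<forall>\<phi>\<in>S. \<phi> v = 0"
  using assms(1,2,6,7)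
proof (induction S arbitrary: G rule: finite_induct)
  case empty
  have "\<not> B \<subseteq> cfun.span G"
    using cfun.independent_span_bound[OF empty(2) B] empty by auto
  then show ?case using cfun.span_base[of _ B] by auto
next
  case (insert \<phi> S)
  have spV: "cfun.span B \<subseteq> V" by (rule cfun.span_minimal[OF V(2,1)])
  obtain v where v: "v \<in> cfun.span B" "v \<notin> cfun.span G" "\<forall>\<psi>\<in>S. \<psi> v = 0"
    using insert.IH[of G] insert.prems insert.hyps by auto
  show ?case
  proof (cases "\<phi> v = 0")
    case True
    then show ?thesis using v by auto
  next
    case False
    have "card (insert v G) \<le> Suc (card G)" by (rule card_insert_le_m1) simp_all
    then obtain u where u: "u \<in> cfun.span B" "u \<notin> cfun.span (insert v G)" "\<forall>\<psi>\<in>S. \<psi> u = 0"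
      using insert.IH[of "insert v G"] insert.prems insert.hyps by auto
    let ?u = "fscale (- (\<phi> u / \<phi> v)) v + u"
    have lin: "\<psi> ?u = - (\<phi> u / \<phi> v) * \<psi> v + \<psi> u" if "\<psi> \<in> insert \<phi> S" for \<psi>
      by (rule linear_functional_onD[of V]) (use that insert.prems spV u v in auto)
    have "?u \<in> cfun.span B" using u v by (intro cfun.span_add cfun.span_scale)
    moreover have "?u \<notin> cfun.span G"
    proof
      assume "?u \<in> cfun.span G"
      then have "?u \<in> cfun.span (insert v G)" using cfun.span_mono[of G "insert v G"] by auto
      moreover have "fscale (\<phi> u / \<phi> v) v \<in> cfun.span (insert v G)"
        by (intro cfun.span_scale cfun.span_base) simp
      ultimately have "fscale (\<phi> u / \<phi> v) v + ?u \<in> cfun.span (insert v G)"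
        by (rule cfun.span_add[rotated])
      moreover have "fscale (\<phi> u / \<phi> v) v + ?u = u"
        by (simp add: fscale_def fun_eq_iff)
      ultimately show False using u by simp
    qed
    moreover have "\<forall>\<psi>\<in>insert \<phi> S. \<psi> ?u = 0"
    proof
      fix \<psi> assume "\<psi> \<in> insert \<phi> S"
      then show "\<psi> ?u = 0" using u v False by (subst lin) auto
    qed
    ultimately show ?thesis by blast
  qed
qed

text \<open>Ordered independence. It includes injectivity of \<open>f\<close> on
  \<open>{..<n}\<close>, which independence of the image as a set would not, and it supports
  extension by one vector at a time.\<close>

definition indep_seq :: "(nat \<Rightarrow> 'a \<Rightarrow> complex) \<Rightarrow> nat \<Rightarrow> bool" where
  "indep_seq f n \<longleftrightarrow> (\<forall>j<n. f j \<notin> cfun.span (f ` {..<j}))"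

lemma indep_seq_independent:
  "indep_seq f n \<Longrightarrow> cfun.independent (f ` {..<n}) \<and> card (f ` {..<n}) = n"
proof (induction n)
  case 0
  then show ?case by (simp add: cfun.independent_empty)
next
  case (Suc n)
  then have *: "f n \<notin> cfun.span (f ` {..<n})" and "indep_seq f n"
    by (simp_all add: indep_seq_def)
  then have "f n \<notin> f ` {..<n}" using cfun.span_base[of "f n" "f ` {..<n}"] by argo
  then show ?case
    using Suc.IH[OF \<open>indep_seq f n\<close>] cfun.independent_insertI[OF *]
    by (simp add: lessThan_Suc)
qed

lemma indep_seq_fun_upd:
  assumes "indep_seq g p" "v \<notin> cfun.span (g ` {..<p})"
  shows "indep_seq (g(p := v)) (Suc p)"
proof -
  have "(g(p := v)) j \<notin> cfun.span ((g(p := v)) ` {..<j})" if "j < Suc p" for j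
  proof -
    have "(g(p := v)) ` {..<j} = g ` {..<j}" using that by (intro image_cong) auto
    then show ?thesis using assms that by (cases "j = p") (simp_all only: indep_seq_def fun_upd_apply if_True if_False less_Suc_eq, simp_all)
  qed
  then show ?thesis by (simp only: indep_seq_def) blast
qed

text \<open>The vector \<open>g p\<close> must satisfy at most \<open>n - Suc p\<close> conditions
  and avoid the span of the \<open>p\<close> vectors chosen before it: \<open>n - 1\<close>
  constraints in an \<open>n\<close>-dimensional space. Taking the longest lists of conditions first
  makes the numbers balance, hence the reversed index.\<close>

lemma ex_graded_basis:
  assumes f: "indep_seq f n" "\<And>j. j < n \<Longrightarrow> f j \<in> V" and V: "cfun.subspace V"
    and S: "\<And>k. k < n \<Longrightarrow> finite (S k) \<and> card (S k) \<le> k \<and> (\<forall>\<phi>\<in>S k. linear_functional_on V \<phi>)"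
  obtains g where "indep_seq g n" "\<And>p. p < n \<Longrightarrow> g p \<in> cfun.span (f ` {..<n})"
    "\<And>p \<phi>. p < n \<Longrightarrow> \<phi> \<in> S (n - Suc p) \<Longrightarrow> \<phi> (g p) = 0"
proof -
  have "\<exists>g. indep_seq g p \<and> (\<forall>q<p. g q \<in> cfun.span (f ` {..<n}) \<and> (\<forall>\<phi>\<in>S (n - Suc q). \<phi> (g q) = 0))"
    if "p \<le> n" for p
    using that
  proof (induction p)
    case 0
    then show ?case by (simp add: indep_seq_def)
  next
    case (Suc p)
    then obtain g where g: "indep_seq g p"
      "\<And>q. q < p \<Longrightarrow> g q \<in> cfun.span (f ` {..<n}) \<and> (\<forall>\<phi>\<in>S (n - Suc q). \<phi> (g q) = 0)"
      by auto
    have Sp: "finite (S (n - Suc p)) \<and> card (S (n - Suc p)) \<le> n - Suc p \<and>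
        (\<forall>\<phi>\<in>S (n - Suc p). linear_functional_on V \<phi>)"
      by (rule S) (use Suc.prems in simp)
    have "card (g ` {..<p}) \<le> p" using card_image_le[of "{..<p}" g] by simp
    then have "card (S (n - Suc p)) + card (g ` {..<p}) < card (f ` {..<n})"
      using indep_seq_independent[OF f(1)] Sp Suc.prems by linarith
    then obtain v where v: "v \<in> cfun.span (f ` {..<n})" "v \<notin> cfun.span (g ` {..<p})"
        "\<forall>\<phi>\<in>S (n - Suc p). \<phi> v = 0"
      using ex_span_kernel_not_in_span[of "S (n - Suc p)" V "f ` {..<n}" "g ` {..<p}"]
        Sp V f indep_seq_independent[OF f(1)] by auto
    have "indep_seq (g(p := v)) (Suc p)" by (rule indep_seq_fun_upd[OF g(1) v(2)])
    moreover have "\<forall>q<Suc p. (g(p := v)) q \<in> cfun.span (f ` {..<n}) \<and>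
        (\<forall>\<phi>\<in>S (n - Suc q). \<phi> ((g(p := v)) q) = 0)"
      using g(2) v by (simp add: less_Suc_eq)
    ultimately show ?case by blast
  qed
  from this[of n] show ?thesis using that by blast
qed

lemma span_lessThan_coords:
  assumes "x \<in> cfun.span (f ` {..<n::nat})"
  obtains q where "\<And>z. x z = (\<Sum>j<n. q j * f j z)"
proof -
  let ?W = "{x. \<exists>q. \<forall>z. x z = (\<Sum>j<n. q j * f j z)}"
  have "cfun.span (f ` {..<n}) \<subseteq> ?W"
  proof (rule cfun.span_minimal)
    show "f ` {..<n} \<subseteq> ?W"
    proof clarify
      fix i assume "i < n"
      then have "\<forall>z. f i z = (\<Sum>j<n. (if j = i then 1 else 0) * f j z)"
        by (simp add: if_distrib[where f="\<lambda>x. x * _"] cong: if_cong)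
      then show "\<exists>q. \<forall>z. f i z = (\<Sum>j<n. q j * f j z)"
        by (intro exI[of _ "\<lambda>j. if j = i then 1 else 0"])
    qed
    show "cfun.subspace ?W"
    proof (rule cfun.subspaceI)
      show "0 \<in> ?W" by (auto intro!: exI[of _ "\<lambda>_. 0"])
    next
      fix x y assume "x \<in> ?W" "y \<in> ?W"
      then obtain q r where "\<forall>z. x z = (\<Sum>j<n. q j * f j z)" "\<forall>z. y z = (\<Sum>j<n. r j * f j z)" by auto
      then have "\<forall>z. (x + y) z = (\<Sum>j<n. (q j + r j) * f j z)"
        by (simp add: sum.distrib algebra_simps)
      then show "x + y \<in> ?W" by (intro CollectI exI[of _ "\<lambda>j. q j + r j"])
    next
      fix x a assume "x \<in> ?W"
      then obtain q where "\<forall>z. x z = (\<Sum>j<n. q j * f j z)" by auto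
      then have "\<forall>z. fscale a x z = (\<Sum>j<n. (a * q j) * f j z)"
        by (simp add: fscale_def sum_distrib_left mult.assoc)
      then show "fscale a x \<in> ?W" by (intro CollectI exI[of _ "\<lambda>j. a * q j"])
    qed
  qed
  then show ?thesis using assms that by blast
qed

lemma span_lessThanI:
  "(\<And>z. x z = (\<Sum>j<n. q j * f j z)) \<Longrightarrow> x \<in> cfun.span (f ` {..<n::nat})"
proof (induction n arbitrary: x)
  case 0
  then have "x = 0" by (simp add: fun_eq_iff)
  then show ?case by (simp only: cfun.span_zero)
next
  case (Suc n)
  let ?y = "\<lambda>z. \<Sum>j<n. q j * f j z"
  have "?y \<in> cfun.span (f ` {..<Suc n})"
    using Suc.IH[of ?y] cfun.span_mono[of "f ` {..<n}" "f ` {..<Suc n}"]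
    by (meson image_mono lessThan_subset_iff le_SucI order_refl subsetD)
  moreover have "fscale (q n) (f n) \<in> cfun.span (f ` {..<Suc n})"
    by (intro cfun.span_scale cfun.span_base) simp
  ultimately have "?y + fscale (q n) (f n) \<in> cfun.span (f ` {..<Suc n})" by (rule cfun.span_add)
  moreover have "x = ?y + fscale (q n) (f n)"
    using Suc.prems by (simp add: fun_eq_iff fscale_def)
  ultimately show ?case by (simp only:)
qed

section \<open>Endomorphisms and their generalized eigenspaces\<close>

locale linear_endo =
  fixes V :: "('a \<Rightarrow> complex) set" and L :: "('a \<Rightarrow> complex) \<Rightarrow> 'a \<Rightarrow> complex"
  assumes V: "cfun.subspace V"
    and closed: "f \<in> V \<Longrightarrow> L f \<in> V"
    and lin: "f \<in> V \<Longrightarrow> g \<in> V \<Longrightarrow> L (fscale a f + g) = fscale a (L f) + L g"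
begin

lemma linear_endo_shift: "linear_endo V (\<lambda>g. L g - fscale \<mu> g)"
proof
  fix f g a assume "f \<in> V" "g \<in> V"
  then show "L (fscale a f + g) - fscale \<mu> (fscale a f + g) =
      fscale a (L f - fscale \<mu> f) + (L g - fscale \<mu> g)"
    by (simp add: lin) (simp add: fscale_def fun_eq_iff algebra_simps)
qed (auto intro!: cfun.subspace_diff cfun.subspace_scale V closed)

lemma linear_endo_pow: "linear_endo V (L ^^ k)"
proof -
  have "(\<forall>f\<in>V. (L ^^ k) f \<in> V) \<and> (\<forall>f\<in>V. \<forall>g\<in>V. \<forall>a. (L ^^ k) (fscale a f + g) = fscale a ((L ^^ k) f) + (L ^^ k) g)"
  proof (induction k)
    case (Suc k)
    show ?case
    proof (intro conjI ballI allI)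
      fix f g a assume "f \<in> V" "g \<in> V"
      then have fg: "(L ^^ k) f \<in> V" "(L ^^ k) g \<in> V"
        "(L ^^ k) (fscale a f + g) = fscale a ((L ^^ k) f) + (L ^^ k) g" using Suc by blast+
      show "(L ^^ Suc k) (fscale a f + g) = fscale a ((L ^^ Suc k) f) + (L ^^ Suc k) g"
        by (simp only: funpow.simps o_apply fg lin[OF fg(1,2)])
    qed (use Suc closed in simp)
  qed simp
  then show ?thesis by unfold_locales (auto intro: V)
qed

lemma map_0: "L 0 = 0"
proof -
  have "L (fscale (- 1) 0 + 0) = fscale (- 1) (L 0) + L 0"
    using cfun.subspace_0[OF V] by (intro lin)
  moreover have "fscale (- 1) 0 + 0 = (0 :: 'a \<Rightarrow> complex)" "fscale (- 1) (L 0) + L 0 = 0"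
    by (simp_all add: fscale_def fun_eq_iff)
  ultimately show ?thesis by (simp only:)
qed

lemma map_span:
  assumes "S \<subseteq> V" "\<And>s. s \<in> S \<Longrightarrow> L s \<in> cfun.span S" "x \<in> cfun.span S"
  shows "L x \<in> cfun.span S"
proof -
  have "cfun.span S \<subseteq> {x\<in>V. L x \<in> cfun.span S}"
  proof (rule cfun.span_minimal)
    show "S \<subseteq> {x \<in> V. L x \<in> cfun.span S}" using assms by auto
    show "cfun.subspace {x \<in> V. L x \<in> cfun.span S}"
    proof (rule cfun.subspaceI)
      show "0 \<in> {x \<in> V. L x \<in> cfun.span S}"
        using cfun.subspace_0[OF V] by (simp add: map_0 cfun.span_zero)
    next
      fix x y assume "x \<in> {x \<in> V. L x \<in> cfun.span S}" "y \<in> {x \<in> V. L x \<in> cfun.span S}"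
      then show "x + y \<in> {x \<in> V. L x \<in> cfun.span S}"
        using lin[of x y 1] by (simp add: cfun.span_add cfun.subspace_add[OF V])
    next
      fix x a assume "x \<in> {x \<in> V. L x \<in> cfun.span S}"
      then show "fscale a x \<in> {x \<in> V. L x \<in> cfun.span S}"
        using lin[of x 0 a] cfun.subspace_0[OF V]
        by (simp add: cfun.span_scale cfun.subspace_scale[OF V] map_0)
    qed
  qed
  then show ?thesis using assms by auto
qed

lemma pow_zero_mono: "(L ^^ k) x = 0 \<Longrightarrow> k \<le> l \<Longrightarrow> (L ^^ l) x = 0"
  by (rotate_tac, induction l rule: dec_induct) (simp_all only: funpow.simps o_apply map_0)

end

lemma gen_eigenspace_combination:
  assumes "linear_endo V L" "f \<in> gen_eigenspace V L \<mu>" "g \<in> gen_eigenspace V L \<mu>"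
  shows "fscale a f + g \<in> gen_eigenspace V L \<mu>"
proof -
  interpret N: linear_endo V "\<lambda>g. L g - fscale \<mu> g"
    using assms(1) by (rule linear_endo.linear_endo_shift)
  let ?N = "\<lambda>g. L g - fscale \<mu> g"
  from assms obtain k l where kl: "f \<in> V" "g \<in> V" "(?N ^^ k) f = 0" "(?N ^^ l) g = 0"
    unfolding gen_eigenspace_def by auto
  interpret P: linear_endo V "?N ^^ (max k l)" by (rule N.linear_endo_pow)
  have "(?N ^^ max k l) (fscale a f + g) = 0"
    using P.lin[OF kl(1,2)] N.pow_zero_mono[OF kl(3), of "max k l"] N.pow_zero_mono[OF kl(4), of "max k l"]
    by (simp add: fscale_def zero_fun_def)
  moreover have "fscale a f + g \<in> V"
    using kl by (intro cfun.subspace_add[OF N.V] cfun.subspace_scale[OF N.V])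
  ultimately show ?thesis unfolding gen_eigenspace_def by blast
qed

definition triangular_seq ::
  "('a \<Rightarrow> complex) set \<Rightarrow> (('a \<Rightarrow> complex) \<Rightarrow> 'a \<Rightarrow> complex) \<Rightarrow> (nat \<Rightarrow> complex) \<Rightarrow>
   (nat \<Rightarrow> 'a \<Rightarrow> complex) \<Rightarrow> nat \<Rightarrow> bool" where
  "triangular_seq V L lam f n \<longleftrightarrow> indep_seq f n \<and>
     (\<forall>j<n. f j \<in> V \<and> L (f j) - fscale (lam j) (f j) \<in> cfun.span (f ` {..<j}))"

lemma triangular_seq_invariant:
  assumes "linear_endo V L" "triangular_seq V L lam f n" "j \<le> n" "x \<in> cfun.span (f ` {..<j})"
  shows "L x - fscale \<mu> x \<in> cfun.span (f ` {..<j})"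
proof -
  interpret linear_endo V L by fact
  have "L x \<in> cfun.span (f ` {..<j})"
  proof (rule map_span[OF _ _ assms(4)])
    show "f ` {..<j} \<subseteq> V" using assms(2,3) by (auto simp: triangular_seq_def)
    fix s assume "s \<in> f ` {..<j}"
    then obtain i where i: "i < j" "s = f i" by auto
    then have "L (f i) - fscale (lam i) (f i) \<in> cfun.span (f ` {..<i})"
      using assms(2,3) by (auto simp: triangular_seq_def)
    then have "L (f i) - fscale (lam i) (f i) \<in> cfun.span (f ` {..<j})"
      using cfun.span_mono[of "f ` {..<i}" "f ` {..<j}"] i by (meson image_mono in_mono lessThan_subset_iff less_imp_le)
    moreover have "fscale (lam i) (f i) \<in> cfun.span (f ` {..<j})"
      using i by (intro cfun.span_scale cfun.span_base) auto
    ultimately have "(L (f i) - fscale (lam i) (f i)) + fscale (lam i) (f i) \<in> cfun.span (f ` {..<j})"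
      by (rule cfun.span_add)
    then show "L s \<in> cfun.span (f ` {..<j})" using i by simp
  qed
  then show ?thesis using assms(4) by (intro cfun.span_diff cfun.span_scale)
qed

text \<open>Modulo the span of the earlier vectors, \<open>L - \<mu>\<close> multiplies the
  coefficient of \<open>f j\<close> by \<open>lam j - \<mu>\<close>. A generalized eigenvector with
  non-zero coefficient there forces \<open>lam j = \<mu>\<close>, and two such vectors have a
  combination without that coefficient. So each index with \<open>lam j = \<mu>\<close> adds at most
  one generator, and no other index adds any.\<close>

lemma gen_eigenspace_triangular_bound:
  assumes endo: "linear_endo V L" and tri: "triangular_seq V L lam f n" and "j \<le> n"
  shows "\<exists>S. finite S \<and> card S \<le> card {i. i < j \<and> lam i = \<mu>} \<and>
    gen_eigenspace V L \<mu> \<inter> cfun.span (f ` {..<j}) \<subseteq> cfun.span S"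
  using \<open>j \<le> n\<close>
proof (induction j)
  case 0
  show ?case by (rule exI[of _ "{}"]) auto
next
  case (Suc j)
  interpret linear_endo V L by fact
  interpret N: linear_endo V "\<lambda>g. L g - fscale \<mu> g" by (rule linear_endo_shift)
  let ?N = "\<lambda>g. L g - fscale \<mu> g"
  let ?E = "gen_eigenspace V L \<mu>"
  let ?W = "cfun.span (f ` {..<j})"
  have fj: "f j \<in> V" "f j \<notin> ?W" "L (f j) - fscale (lam j) (f j) \<in> ?W"
    using tri Suc.prems by (auto simp: triangular_seq_def indep_seq_def)
  have WV: "?W \<subseteq> V"
    by (rule cfun.span_minimal[OF _ V]) (use tri Suc.prems in \<open>auto simp: triangular_seq_def\<close>)
  have split: "\<exists>a. x - fscale a (f j) \<in> ?W" if "x \<in> cfun.span (f ` {..<Suc j})" for x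
    using that cfun.span_breakdown_eq[of x "f j" "f ` {..<j}"] by (simp add: lessThan_Suc)
  obtain S where S: "finite S" "card S \<le> card {i. i < j \<and> lam i = \<mu>}" "?E \<inter> ?W \<subseteq> cfun.span S"
    using Suc by auto
  show ?case
  proof (cases "?E \<inter> cfun.span (f ` {..<Suc j}) \<subseteq> ?W")
    case True
    have "card {i. i < j \<and> lam i = \<mu>} \<le> card {i. i < Suc j \<and> lam i = \<mu>}"
      by (rule card_mono) auto
    then show ?thesis using S True by (intro exI[of _ S]) auto
  next
    case False
    then obtain e where e: "e \<in> ?E" "e \<in> cfun.span (f ` {..<Suc j})" "e \<notin> ?W" by auto
    obtain b where b: "e - fscale b (f j) \<in> ?W" using split[OF e(2)] by auto
    have b0: "b \<noteq> 0"
    proof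
      assume "b = 0"
      moreover have "e - fscale 0 (f j) = e" by (simp add: fscale_def fun_eq_iff)
      ultimately show False using b e(3) by metis
    qed
    have "lam j = \<mu>"
    proof (rule ccontr)
      assume ne: "lam j \<noteq> \<mu>"
      \<comment> \<open>Since \<open>lam j - \<mu>\<close> is non-zero, the leading coefficient
        never dies, whereas some power of \<open>?N\<close> annihilates \<open>e\<close>.\<close>
      have pow: "(?N ^^ k) e - fscale (b * (lam j - \<mu>) ^ k) (f j) \<in> ?W" for k
      proof (induction k)
        case 0
        have "(?N ^^ 0) e - fscale (b * (lam j - \<mu>) ^ 0) (f j) = e - fscale b (f j)" by simp
        then show ?case using b by (simp only:)
      next
        case (Suc k)
        let ?c = "b * (lam j - \<mu>) ^ k"
        let ?w = "(?N ^^ k) e - fscale ?c (f j)"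
        have "(?N ^^ Suc k) e = ?N (fscale ?c (f j) + ?w)" by simp
        also have "\<dots> = fscale ?c (?N (f j)) + ?N ?w"
          by (rule N.lin[OF fj(1) subsetD[OF WV Suc.IH]])
        finally have "(?N ^^ Suc k) e - fscale (b * (lam j - \<mu>) ^ Suc k) (f j) =
            fscale ?c (L (f j) - fscale (lam j) (f j)) + ?N ?w"
          by (simp add: fscale_def fun_eq_iff algebra_simps)
        moreover have "?N ?w \<in> ?W"
          using \<open>Suc j \<le> n\<close> by (intro triangular_seq_invariant[OF endo tri _ Suc.IH]) simp
        then have "fscale ?c (L (f j) - fscale (lam j) (f j)) + ?N ?w \<in> ?W"
          by (intro cfun.span_add[OF cfun.span_scale[OF fj(3)]])
        ultimately show ?case by (simp only:)
      qed
      obtain k where "(?N ^^ k) e = 0" using e(1) unfolding gen_eigenspace_def by auto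
      with pow[of k] have "0 - fscale (b * (lam j - \<mu>) ^ k) (f j) \<in> ?W" by simp
      then have "fscale (- inverse (b * (lam j - \<mu>) ^ k)) (0 - fscale (b * (lam j - \<mu>) ^ k) (f j)) \<in> ?W"
        by (rule cfun.span_scale)
      moreover have "fscale (- inverse (b * (lam j - \<mu>) ^ k)) (0 - fscale (b * (lam j - \<mu>) ^ k) (f j)) = f j"
        using b0 ne by (simp add: fscale_def fun_eq_iff del: inverse_mult_distrib)
      ultimately show False using fj(2) by (simp only:)
    qed
    then have "{i. i < Suc j \<and> lam i = \<mu>} = insert j {i. i < j \<and> lam i = \<mu>}"
      by (auto simp: less_Suc_eq)
    then have "card {i. i < Suc j \<and> lam i = \<mu>} = Suc (card {i. i < j \<and> lam i = \<mu>})" by simp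
    moreover have "card (insert e S) \<le> Suc (card S)" by (rule card_insert_le_m1) simp_all
    moreover have "?E \<inter> cfun.span (f ` {..<Suc j}) \<subseteq> cfun.span (insert e S)"
    proof
      fix x assume x: "x \<in> ?E \<inter> cfun.span (f ` {..<Suc j})"
      then obtain a where a: "x - fscale a (f j) \<in> ?W" using split by auto
      let ?y = "fscale (- (a / b)) e + x"
      have "?y \<in> ?E" using x e by (intro gen_eigenspace_combination[OF endo]) auto
      moreover have "?y \<in> ?W"
      proof -
        have "?y = fscale (- (a / b)) (e - fscale b (f j)) + (x - fscale a (f j))"
          using b0 by (simp add: fscale_def fun_eq_iff algebra_simps)
        also have "\<dots> \<in> ?W" by (intro cfun.span_add[OF cfun.span_scale[OF b] a])
        finally show ?thesis .
      qed
      ultimately have "?y \<in> cfun.span (insert e S)"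
        using S(3) cfun.span_mono[of S "insert e S"] by auto
      moreover have "fscale (a / b) e \<in> cfun.span (insert e S)"
        by (intro cfun.span_scale cfun.span_base) simp
      ultimately have "fscale (a / b) e + ?y \<in> cfun.span (insert e S)" by (rule cfun.span_add[rotated])
      moreover have "fscale (a / b) e + ?y = x" by (simp add: fscale_def fun_eq_iff)
      ultimately show "x \<in> cfun.span (insert e S)" by simp
    qed
    ultimately show ?thesis using S by (intro exI[of _ "insert e S"]) auto
  qed
qed

text \<open>Algebraic multiplicity enters here. The list contains \<open>\<mu> = ev (Suc n)\<close>
  at least once more than its first \<open>n\<close> entries do, so by the preceding bound the
  generalized eigenspace of \<open>\<mu>\<close> is not yet contained in the span of the first
  \<open>n\<close> vectors.\<close>

lemma ex_triangular_seq:
  assumes endo: "linear_endo V L" and ev: "eigenvalue_sequence V L ev"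
    and nz: "\<And>k. 1 \<le> k \<Longrightarrow> k \<le> n \<Longrightarrow> ev k \<noteq> 0"
  shows "\<exists>f. triangular_seq V L (\<lambda>j. ev (Suc j)) f n"
  using nz
proof (induction n)
  case 0
  show ?case by (auto simp: triangular_seq_def indep_seq_def)
next
  case (Suc n)
  let ?lam = "\<lambda>j. ev (Suc j)"
  obtain f where tri: "triangular_seq V L ?lam f n" using Suc by auto
  define \<mu> where "\<mu> = ev (Suc n)"
  let ?N = "\<lambda>g. L g - fscale \<mu> g"
  let ?W = "cfun.span (f ` {..<n})"
  let ?A = "{k. 1 \<le> k \<and> ev k = \<mu>}"
  interpret linear_endo V L by fact
  interpret N: linear_endo V ?N by (rule linear_endo_shift)
  have "\<mu> \<noteq> 0" using Suc.prems by (simp add: \<mu>_def)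
  then have fin: "finite ?A" and card: "card ?A = alg_mult V L \<mu>"
    using ev by (auto simp: eigenvalue_sequence_def)
  have "\<not> gen_eigenspace V L \<mu> \<subseteq> ?W"
  proof
    assume sub: "gen_eigenspace V L \<mu> \<subseteq> ?W"
    obtain S where S: "finite S" "card S \<le> card {i. i < n \<and> ?lam i = \<mu>}"
        "gen_eigenspace V L \<mu> \<inter> ?W \<subseteq> cfun.span S"
      using gen_eigenspace_triangular_bound[OF endo tri order_refl, of \<mu>] by auto
    then have "alg_mult V L \<mu> \<le> card S"
      unfolding alg_mult_def using sub by (intro cfun.dim_le_card) auto
    moreover have "card {i. i < n \<and> ?lam i = \<mu>} = card (Suc ` {i. i < n \<and> ?lam i = \<mu>})"
      by (simp add: card_image)
    \<comment> \<open>The inclusion is strict because the index \<open>Suc n\<close> itself lies in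
      \<open>?A\<close> but not in the image.\<close>
    moreover have "card (Suc ` {i. i < n \<and> ?lam i = \<mu>}) < card ?A"
      by (rule psubset_card_mono[OF fin]) (auto simp: \<mu>_def)
    ultimately show False using S card by linarith
  qed
  then obtain x where x: "x \<in> gen_eigenspace V L \<mu>" "x \<notin> ?W" by auto
  then obtain k where k: "x \<in> V" "(?N ^^ k) x = 0" unfolding gen_eigenspace_def by auto
  have "(?N ^^ k) x \<in> ?W" using k by (simp add: cfun.span_zero)
  \<comment> \<open>The iterate just before the first one in \<open>?W\<close> is the new basis
    vector: one more application of \<open>?N\<close> lands in \<open>?W\<close>, which is
    triangularity.\<close>
  then obtain l where l: "(?N ^^ l) x \<notin> ?W" "(?N ^^ Suc l) x \<in> ?W"
    using x(2) ex_least_nat_le[of "\<lambda>k. (?N ^^ k) x \<in> ?W" k]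
    by (metis (no_types, lifting) funpow_0 less_Suc_eq not0_implies_Suc)
  let ?v = "(?N ^^ l) x"
  interpret P: linear_endo V "?N ^^ l" by (rule N.linear_endo_pow)
  have "triangular_seq V L ?lam (f(n := ?v)) (Suc n)"
  proof -
    have indep: "indep_seq (f(n := ?v)) (Suc n)"
      using tri l(1) by (intro indep_seq_fun_upd) (auto simp: triangular_seq_def)
    have img: "(f(n := ?v)) ` {..<j} = f ` {..<j}" if "j \<le> n" for j
      using that by (intro image_cong) auto
    have "?v \<in> V" using P.closed[OF k(1)] .
    have "L ?v - fscale (ev (Suc n)) ?v \<in> ?W" using l(2) by (simp add: \<mu>_def)
    have last: "(f(n := ?v)) j \<in> V \<and> L ((f(n := ?v)) j) - fscale (?lam j) ((f(n := ?v)) j) \<in>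
        cfun.span ((f(n := ?v)) ` {..<j})" if "j < Suc n" for j
    proof (cases "j = n")
      case True
      show ?thesis
        unfolding True img[OF order_refl] fun_upd_same
        using \<open>?v \<in> V\<close> \<open>L ?v - fscale (ev (Suc n)) ?v \<in> ?W\<close> by (rule conjI)
    next
      case False
      then have "j < n" using that by simp
      then show ?thesis
        unfolding img[OF less_imp_le[OF \<open>j < n\<close>]] fun_upd_other[OF False]
        using tri by (simp only: triangular_seq_def)
    qed
    show ?thesis
      unfolding triangular_seq_def by (intro conjI[OF indep] allI impI last)
  qed
  then show ?case by blast
qed

section \<open>Determinants of functions evaluated at points\<close>

text \<open>
  In the applications the rows are indexed by functions and the columns by points.
\<close>

definition fdet :: "nat \<Rightarrow> (nat \<Rightarrow> nat \<Rightarrow> complex) \<Rightarrow> complex" where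
  "fdet n A = Determinant.det (Matrix.mat n n (\<lambda>(j, k). A j k))"

lemma fdet_cong: "(\<And>j k. j < n \<Longrightarrow> k < n \<Longrightarrow> A j k = B j k) \<Longrightarrow> fdet n A = fdet n B"
  unfolding fdet_def by (intro arg_cong[where f="Determinant.det"] eq_matI) auto

lemma fdet_expand:
  "fdet n A = (\<Sum>p | p permutes {0..<n}. signof p * (\<Prod>i=0..<n. A i (p i)))"
proof -
  have "fdet n A = (\<Sum>p | p permutes {0..<n}. signof p *
      (\<Prod>i=0..<n. Matrix.mat n n (\<lambda>(j, k). A j k) $$ (i, p i)))"
    unfolding fdet_def by (rule det_def') simp
  also have "\<dots> = (\<Sum>p | p permutes {0..<n}. signof p * (\<Prod>i=0..<n. A i (p i)))"
  proof (intro sum.cong refl arg_cong2[where f="(*)"] prod.cong)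
    fix p i assume "p \<in> {p. p permutes {0..<n}}" "i \<in> {0..<n}"
    then have "p i < n" "i < n" using permutes_in_image[of p "{0..<n}" i] by auto
    then show "Matrix.mat n n (\<lambda>(j, k). A j k) $$ (i, p i) = A i (p i)" by simp
  qed
  finally show ?thesis .
qed

lemma fdet_mult: "fdet n (\<lambda>j k. \<Sum>l<n. Q j l * A l k) = fdet n Q * fdet n A"
proof -
  have "Matrix.mat n n (\<lambda>(j, k). \<Sum>l<n. Q j l * A l k) =
      Matrix.mat n n (\<lambda>(j, k). Q j k) * Matrix.mat n n (\<lambda>(j, k). A j k)"
    by (rule eq_matI) (auto simp: scalar_prod_def lessThan_atLeast0)
  then show ?thesis unfolding fdet_def by (simp add: Determinant.det_mult[of _ n])
qed

lemma fdet_lower_triangular: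
  assumes "\<And>i j. i < j \<Longrightarrow> j < n \<Longrightarrow> A i j = 0"
  shows "fdet n A = (\<Prod>i<n. A i i)"
proof -
  have "fdet n A = prod_list (diag_mat (Matrix.mat n n (\<lambda>(j, k). A j k)))"
    unfolding fdet_def by (rule det_lower_triangular[of n]) (use assms in auto)
  then show ?thesis by (simp add: prod_list_diag_prod lessThan_atLeast0)
qed

text \<open>The coefficients of the Laplace expansion along column \<open>k\<close> are cofactors,
  which do not involve that column, so \<open>C\<close> can be chosen before
  \<open>v\<close>.\<close>

lemma fdet_column:
  assumes "k < n"
  obtains C where "\<And>v. fdet n (\<lambda>j l. if l = k then v j else A j l) = (\<Sum>j<n. v j * C j)"
proof -
  let ?M = "\<lambda>v. Matrix.mat n n (\<lambda>(j, l). if l = k then v j else A j l)"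
  have "fdet n (\<lambda>j l. if l = k then v j else A j l) = (\<Sum>j<n. v j * cofactor (?M (\<lambda>_. 0)) j k)" for v
  proof -
    have "fdet n (\<lambda>j l. if l = k then v j else A j l) = (\<Sum>j<n. ?M v $$ (j, k) * cofactor (?M v) j k)"
      unfolding fdet_def by (rule laplace_expansion_column) (use assms in auto)
    also have "\<dots> = (\<Sum>j<n. v j * cofactor (?M (\<lambda>_. 0)) j k)"
    proof (intro sum.cong refl arg_cong2[where f="(*)"])
      fix j assume "j \<in> {..<n}"
      then show "?M v $$ (j, k) = v j" using assms by simp
      have "mat_delete (?M v) j k = mat_delete (?M (\<lambda>_. 0)) j k"
        unfolding mat_delete_def by (rule eq_matI) (use assms in auto)
      then show "cofactor (?M v) j k = cofactor (?M (\<lambda>_. 0)) j k" by (simp add: cofactor_def)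
    qed
    finally show ?thesis .
  qed
  then show ?thesis by (rule that)
qed

text \<open>Evaluating the expansion at the last unit vector identifies the coefficient of the
  corner entry as the leading minor, which is what an induction on \<open>n\<close> needs.\<close>

lemma fdet_last_column:
  obtains C where "C n = fdet n A"
    "\<And>v. fdet (Suc n) (\<lambda>j l. if l = n then v j else A j l) = (\<Sum>j<Suc n. v j * C j)"
proof -
  obtain C where C: "\<And>v. fdet (Suc n) (\<lambda>j l. if l = n then v j else A j l) = (\<Sum>j<Suc n. v j * C j)"
    using fdet_column[of n "Suc n" A] by blast
  let ?M = "Matrix.mat (Suc n) (Suc n) (\<lambda>(j, l). if l = n then (if j = n then 1 else 0) else A j l)"
  have "C n = (\<Sum>j<Suc n. (if j = n then 1 else 0) * C j)" by simp
  also have "\<dots> = Determinant.det ?M" by (simp only: C[symmetric] fdet_def)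
  also have "\<dots> = (\<Sum>j<Suc n. ?M $$ (j, n) * cofactor ?M j n)"
    by (rule laplace_expansion_column) auto
  also have "\<dots> = cofactor ?M n n" by simp
  also have "\<dots> = Determinant.det (mat_delete ?M n n)" by (simp add: cofactor_def)
  also have "mat_delete ?M n n = Matrix.mat n n (\<lambda>(j, k). A j k)"
    unfolding mat_delete_def by (rule eq_matI) auto
  finally have "C n = fdet n A" by (simp add: fdet_def)
  then show ?thesis using C by (rule that)
qed

lemma norm_fdet_le:
  assumes "\<And>j k. j < n \<Longrightarrow> k < n \<Longrightarrow> norm (A j k) \<le> B j"
  shows "norm (fdet n A) \<le> fact n * (\<Prod>j=0..<n. B j)"
proof -
  have "norm (fdet n A) \<le> (\<Sum>p | p permutes {0..<n}. \<Prod>j=0..<n. B j)"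
    unfolding fdet_expand
  proof (rule sum_norm_le)
    fix p assume "p \<in> {p. p permutes {0..<n}}"
    then have p: "p i < n" if "i < n" for i using permutes_in_image[of p "{0..<n}" i] that by auto
    have "norm (signof p * (\<Prod>i=0..<n. A i (p i))) = (\<Prod>i=0..<n. norm (A i (p i)))"
      by (simp add: norm_mult prod_norm sign_def)
    also have "\<dots> \<le> (\<Prod>j=0..<n. B j)" by (rule prod_mono) (use assms p in auto)
    finally show "norm (signof p * (\<Prod>i=0..<n. A i (p i))) \<le> (\<Prod>j=0..<n. B j)" .
  qed
  then show ?thesis by (simp add: card_permutations)
qed

text \<open>If the determinant vanished for every choice of the last point, its expansion along the
  last column would express \<open>f n\<close> by the earlier functions, as the leading minor is
  non-zero. The second conjunct serves to locate the points: functions supported in a set force them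
  into that set.\<close>

lemma indep_seq_fdet_nonzero:
  "indep_seq f n \<Longrightarrow> \<exists>x. fdet n (\<lambda>j k. f j (x k)) \<noteq> 0 \<and> (\<forall>k<n. \<exists>j<n. f j (x k) \<noteq> 0)"
proof (induction n)
  case 0
  show ?case by (simp add: fdet_expand)
next
  case (Suc n)
  then obtain x where x: "fdet n (\<lambda>j k. f j (x k)) \<noteq> 0" "\<And>k. k < n \<Longrightarrow> \<exists>j<n. f j (x k) \<noteq> 0"
    by (auto simp: indep_seq_def)
  obtain C where C: "C n = fdet n (\<lambda>j k. f j (x k))"
    "\<And>v. fdet (Suc n) (\<lambda>j l. if l = n then v j else f j (x l)) = (\<Sum>j<Suc n. v j * C j)"
    using fdet_last_column[of n "\<lambda>j k. f j (x k)"] by blast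
  have "\<exists>y. (\<Sum>j<Suc n. f j y * C j) \<noteq> 0"
  proof (rule ccontr)
    assume "\<not> ?thesis"
    then have z: "(\<Sum>j<n. f j y * C j) + f n y * C n = 0" for y by simp
    have "f n y = (\<Sum>j<n. (- C j / C n) * f j y)" for y
    proof -
      have "(\<Sum>j<n. (- C j / C n) * f j y) = - (\<Sum>j<n. f j y * C j) / C n"
        by (simp add: sum_divide_distrib sum_negf mult.commute)
      also have "\<dots> = f n y"
      proof -
        have "C n \<noteq> 0" using x(1) C(1) by simp
        moreover have "f n y * C n = - (\<Sum>j<n. f j y * C j)"
          using z[of y] by (simp add: eq_neg_iff_add_eq_0 add.commute)
        ultimately show ?thesis by (metis nonzero_mult_div_cancel_right)
      qed
      finally show ?thesis by simp
    qed
    then have "f n \<in> cfun.span (f ` {..<n})" by (rule span_lessThanI)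
    then show False using Suc.prems by (simp add: indep_seq_def)
  qed
  then obtain y where y: "(\<Sum>j<Suc n. f j y * C j) \<noteq> 0" by blast
  have "fdet (Suc n) (\<lambda>j k. f j ((x(n := y)) k)) = (\<Sum>j<Suc n. f j y * C j)"
    unfolding C(2)[symmetric] by (rule fdet_cong) simp
  moreover have "\<exists>j<Suc n. f j y \<noteq> 0"
    using y by (metis (no_types, lifting) lessThan_iff mult_zero_left sum.neutral)
  moreover have "\<exists>j<Suc n. f j (x k) \<noteq> 0" if "k < n" for k
    using x(2)[OF that] less_SucI by blast
  ultimately show ?case
    using y by (intro exI[of _ "x(n := y)"]) (simp add: less_Suc_eq)
qed

section \<open>Determinants whose columns are infinite weighted sums\<close>

lemma has_sum_sum_left:
  fixes f :: "'b \<Rightarrow> 'a \<Rightarrow> 'c::topological_comm_monoid_add"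
  assumes "finite A" "\<And>j. j \<in> A \<Longrightarrow> (f j has_sum S j) I"
  shows "((\<lambda>i. \<Sum>j\<in>A. f j i) has_sum (\<Sum>j\<in>A. S j)) I"
  using assms by (induction A rule: finite_induct) (auto intro: has_sum_add)

text \<open>The averaged columns are put in one at a time, each costing a factor \<open>W\<close>
  because the determinant is linear in that column. The induction needs the remaining columns to
  range over all of \<open>Y\<close>.\<close>

lemma norm_fdet_average_le:
  fixes u :: "nat \<Rightarrow> nat \<Rightarrow> complex"
  assumes u: "\<And>k j. k < n \<Longrightarrow> j < n \<Longrightarrow> ((\<lambda>i. a k i * v k i j) has_sum u k j) I"
    and a: "\<And>k. k < n \<Longrightarrow> (\<lambda>i. norm (a k i)) summable_on I"
      "\<And>k. k < n \<Longrightarrow> (\<Sum>\<^sub>\<infinity>i\<in>I. norm (a k i)) \<le> W"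
    and v: "\<And>k i. k < n \<Longrightarrow> i \<in> I \<Longrightarrow> v k i \<in> Y" and "Y \<noteq> {}"
    and B: "\<And>y. (\<And>k. k < n \<Longrightarrow> y k \<in> Y) \<Longrightarrow> norm (fdet n (\<lambda>j k. y k j)) \<le> B"
  shows "norm (fdet n (\<lambda>j k. u k j)) \<le> W ^ n * B"
proof -
  have "norm (fdet n (\<lambda>j k. if k < p then u k j else y k j)) \<le> W ^ p * B"
    if "p \<le> n" "\<And>k. k < n \<Longrightarrow> y k \<in> Y" for p y
    using that
  proof (induction p arbitrary: y)
    case 0
    then show ?case using B[of y] by simp
  next
    case (Suc p)
    then have p: "p < n" by simp
    obtain C where C: "\<And>z. fdet n (\<lambda>j l. if l = p then z j else if l < p then u l j else y l j) =
        (\<Sum>j<n. z j * C j)"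
      using fdet_column[OF p, of "\<lambda>j l. if l < p then u l j else y l j"] by blast
    have "fdet n (\<lambda>j k. if k < Suc p then u k j else y k j) = (\<Sum>j<n. u p j * C j)"
      unfolding C[symmetric] by (rule fdet_cong) auto
    moreover have sum1: "((\<lambda>i. \<Sum>j<n. a p i * v p i j * C j) has_sum (\<Sum>j<n. u p j * C j)) I"
      by (intro has_sum_sum_left has_sum_cmult_left u p) auto
    moreover have sum2: "((\<lambda>i. norm (a p i) * (W ^ p * B)) has_sum ((\<Sum>\<^sub>\<infinity>i\<in>I. norm (a p i)) * (W ^ p * B))) I"
      by (intro has_sum_cmult_left has_sum_infsum a p)
    moreover have le: "norm (\<Sum>j<n. a p i * v p i j * C j) \<le> norm (a p i) * (W ^ p * B)" if "i \<in> I" for i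
    proof -
      have "(\<Sum>j<n. a p i * v p i j * C j) = a p i * (\<Sum>j<n. v p i j * C j)"
        by (simp add: sum_distrib_left mult.assoc)
      also have "(\<Sum>j<n. v p i j * C j) = fdet n (\<lambda>j k. if k < p then u k j else (y(p := v p i)) k j)"
        unfolding C[symmetric] by (rule fdet_cong) auto
      finally show ?thesis
        using Suc.IH[of "y(p := v p i)"] Suc.prems v[OF p that]
        by (simp add: norm_mult mult_left_mono)
    qed
    ultimately have "norm (fdet n (\<lambda>j k. if k < Suc p then u k j else y k j)) \<le>
        (\<Sum>\<^sub>\<infinity>i\<in>I. norm (a p i)) * (W ^ p * B)"
      using norm_infsum_le[OF sum1 sum2 le] by simp
    also have "\<dots> \<le> W * (W ^ p * B)"
    proof (rule mult_right_mono[OF a(2)[OF p]])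
      show "0 \<le> W ^ p * B"
        using Suc.IH[of y] Suc.prems norm_ge_zero by (meson Suc_leD order_trans)
    qed
    finally show ?case by (simp add: mult.assoc)
  qed
  \<comment> \<open>With \<open>p = n\<close> the fallback columns never occur in the determinant;
    they only have to lie in \<open>Y\<close>.\<close>
  from this[of n "\<lambda>_. SOME y. y \<in> Y"] have
    "norm (fdet n (\<lambda>j k. if k < n then u k j else (SOME y. y \<in> Y) j)) \<le> W ^ n * B"
    using \<open>Y \<noteq> {}\<close> by (simp add: some_in_eq)
  also have "fdet n (\<lambda>j k. if k < n then u k j else (SOME y. y \<in> Y) j) = fdet n (\<lambda>j k. u k j)"
    by (rule fdet_cong) simp
  finally show ?thesis .
qed

section \<open>Holomorphic functions of several variables\<close>

lemma norm_vector_scalar_mult: "norm (a *s (x::complex^'n)) = norm a * norm x"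
  by (simp add: Finite_Cartesian_Product.norm_vec_def norm_mult L2_set_right_distrib)

lemma bounded_linear_vector_scalar_left: "bounded_linear (\<lambda>s::complex. s *s (b::complex^'n))"
proof (rule bounded_linear_intro)
  show "norm (s *s b) \<le> norm s * norm b" for s by (simp add: norm_vector_scalar_mult)
qed (simp_all add: Finite_Cartesian_Product.vec_eq_iff algebra_simps)

text \<open>A real derivative is already additive, so complex linearity reduces to complex
  homogeneity.\<close>

lemma holo_on_alt:
  "holo_on (*) f D \<longleftrightarrow> (\<forall>z\<in>D. \<exists>f'. (f has_derivative f') (at z) \<and> (\<forall>a x. f' (a *s x) = a * f' x))"
proof -
  have "vector_space ((*) :: complex \<Rightarrow> complex \<Rightarrow> complex)"
    by unfold_locales (auto simp: algebra_simps)
  moreover have "vector_space ((*s) :: complex \<Rightarrow> complex^'n \<Rightarrow> complex^'n)"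
    by unfold_locales
  ultimately have "Vector_Spaces.linear (*s) (*) f' \<longleftrightarrow> (\<forall>a x. f' (a *s x) = a * f' x)"
    if "(f has_derivative f') (at z)" for f' :: "complex^'n \<Rightarrow> complex" and f z
    using has_derivative_linear[OF that] by (auto simp: Vector_Spaces.linear_iff linear_add)
  then show ?thesis unfolding holo_on_def by blast
qed

lemma holo_on_vector_alt:
  "holo_on (*s) (f :: complex^'n \<Rightarrow> complex^'m) D \<longleftrightarrow>
    (\<forall>z\<in>D. \<exists>f'. (f has_derivative f') (at z) \<and> (\<forall>a x. f' (a *s x) = a *s f' x))"
proof -
  have "vector_space ((*s) :: complex \<Rightarrow> complex^'m \<Rightarrow> complex^'m)"
    by unfold_locales
  moreover have "vector_space ((*s) :: complex \<Rightarrow> complex^'n \<Rightarrow> complex^'n)"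
    by unfold_locales
  ultimately have "Vector_Spaces.linear (*s) (*s) f' \<longleftrightarrow> (\<forall>a x. f' (a *s x) = a *s f' x)"
    if "(f has_derivative f') (at z)" for f' :: "complex^'n \<Rightarrow> complex^'m" and f z
    using has_derivative_linear[OF that] by (auto simp: Vector_Spaces.linear_iff linear_add)
  then show ?thesis unfolding holo_on_def by blast
qed

lemma has_field_derivative_along_line:
  fixes f :: "complex^'n \<Rightarrow> complex"
  assumes "(f has_derivative f') (at (a + s *s b))" "\<And>a x. f' (a *s x) = a * f' x"
  shows "((\<lambda>s. f (a + s *s b)) has_field_derivative f' b) (at s)"
proof -
  have "((\<lambda>s. a + s *s b) has_derivative (\<lambda>h. 0 + h *s b)) (at s)"
    by (intro has_derivative_add has_derivative_const
        bounded_linear_imp_has_derivative bounded_linear_vector_scalar_left)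
  from has_derivative_compose[OF this assms(1)]
  show ?thesis unfolding has_field_derivative_def by (simp add: assms(2) mult_commute_abs)
qed

lemma holo_on_line_holomorphic:
  assumes "holo_on (*) f D" "\<And>s. s \<in> S \<Longrightarrow> a + s *s b \<in> D"
  shows "(\<lambda>s. f (a + s *s b)) holomorphic_on S"
  unfolding holomorphic_on_def
proof
  fix s assume "s \<in> S"
  then obtain f' where "(f has_derivative f') (at (a + s *s b))" "\<forall>a x. f' (a *s x) = a * f' x"
    using assms unfolding holo_on_alt by blast
  then have "((\<lambda>s. f (a + s *s b)) has_field_derivative f' b) (at s)"
    by (intro has_field_derivative_along_line) auto
  then show "(\<lambda>s. f (a + s *s b)) field_differentiable at s within S"
    by (auto simp: field_differentiable_def intro: has_field_derivative_at_within)
qed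

text \<open>Both are one-variable estimates on the complex line through \<open>z\<close> in the
  direction \<open>h\<close>. Their constants do not depend on the direction, so the remainder bound
  is uniform in \<open>h\<close>.\<close>

lemma holo_on_derivative_bounds:
  fixes z :: "complex^'n"
  assumes hol: "holo_on (*) f D" and ball: "ball z \<delta> \<subseteq> D" and "0 < \<delta>"
    and bound: "\<And>x. x \<in> D \<Longrightarrow> norm (f x) \<le> M"
    and f': "(f has_derivative f') (at z)" "\<And>a x. f' (a *s x) = a * f' x"
  shows "norm (f' h) \<le> 2 * M / \<delta> * norm h"
    and "norm h < \<delta> \<Longrightarrow> norm (f (z + h) - f z - f' h) \<le> 4 * M / \<delta>\<^sup>2 * (norm h)\<^sup>2"
proof -
  have *: "norm (f' h) \<le> 2 * M / \<delta> * norm h \<and>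
    (norm h < \<delta> \<longrightarrow> norm (f (z + h) - f z - f' h) \<le> 4 * M / \<delta>\<^sup>2 * (norm h)\<^sup>2)"
  proof (cases "h = 0")
    case True
    have "f' 0 = 0" using f'(2)[of 0 0] by simp
    then show ?thesis using True by simp
  next
    case False
    \<comment> \<open>With \<open>b\<close> the unit vector in the direction \<open>h\<close>, the
      modulus of the line parameter is the distance from \<open>z\<close>.\<close>
    define s where "s = complex_of_real (norm h)"
    define b where "b = inverse s *s h"
    have s0: "s \<noteq> 0" using False by (simp add: s_def)
    have h: "h = s *s b" using s0 by (simp add: b_def vector_smult_assoc)
    have nb: "norm b = 1" using False by (simp add: b_def s_def norm_vector_scalar_mult norm_inverse)
    define \<phi> where "\<phi> t = f (z + t *s b)" for t
    have in_D: "z + t *s b \<in> D" if "norm t < \<delta>" for t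
      using that ball by (auto simp: dist_norm norm_vector_scalar_mult nb)
    have hol\<phi>: "\<phi> holomorphic_on ball 0 \<delta>"
      unfolding \<phi>_def by (rule holo_on_line_holomorphic[OF hol]) (use in_D in auto)
    have b\<phi>: "norm (\<phi> t) \<le> M" if "norm t < \<delta>" for t
      unfolding \<phi>_def using bound in_D[OF that] by blast
    have "(\<phi> has_field_derivative f' b) (at 0)"
      unfolding \<phi>_def by (rule has_field_derivative_along_line) (use f' in simp_all)
    then have d: "deriv \<phi> 0 = f' b" by (rule DERIV_imp_deriv)
    have "norm (diff_quot \<phi> 0) \<le> 2 * M / \<delta>"
      by (rule diff_quot_norm[OF hol\<phi> \<open>0 < \<delta>\<close> b\<phi>]) (use \<open>0 < \<delta>\<close> in auto)
    then have "norm (f' b) \<le> 2 * M / \<delta>" by (simp add: diff_quot_def d)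
    then have "norm (f' b) * norm h \<le> 2 * M / \<delta> * norm h" by (intro mult_right_mono) auto
    moreover have "norm (f' h) = norm (f' b) * norm h"
      by (subst h) (simp add: f'(2) norm_mult s_def)
    moreover have "norm (f (z + h) - f z - f' h) \<le> 4 * M / \<delta>\<^sup>2 * (norm h)\<^sup>2" if "norm h < \<delta>"
    proof -
      have "norm (\<phi> s - \<phi> 0 - s * deriv \<phi> 0) \<le> 4 * M / \<delta>\<^sup>2 * (norm s)\<^sup>2"
        by (rule holomorphic_first_order_remainder[OF hol\<phi> \<open>0 < \<delta>\<close> b\<phi>]) (use that in \<open>auto simp: s_def\<close>)
      moreover have "\<phi> s = f (z + h)" "\<phi> 0 = f z" "s * deriv \<phi> 0 = f' h"
        by (simp_all add: \<phi>_def d h f'(2))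
      moreover have "norm s = norm h" by (simp add: s_def)
      ultimately show ?thesis by (simp only:)
    qed
    ultimately show ?thesis by simp
  qed
  then show "norm (f' h) \<le> 2 * M / \<delta> * norm h" by blast
  show "norm h < \<delta> \<Longrightarrow> norm (f (z + h) - f z - f' h) \<le> 4 * M / \<delta>\<^sup>2 * (norm h)\<^sup>2"
    using * by blast
qed

lemma has_derivative_quadratic_remainder:
  assumes "bounded_linear F" "0 < \<delta>"
    and rem: "\<And>h. norm h < \<delta> \<Longrightarrow> norm (g (z + h) - g z - F h) \<le> K * (norm h)\<^sup>2"
  shows "(g has_derivative F) (at z)"
  unfolding has_derivative_at
proof
  show "(\<lambda>h. norm (g (z + h) - g z - F h) / norm h) \<midarrow>0\<rightarrow> 0"
  proof (rule tendsto_sandwich)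
    show "(\<lambda>_. 0) \<midarrow>0\<rightarrow> (0::real)" by simp
    show "(\<lambda>h::'a. K * norm h) \<midarrow>0\<rightarrow> 0"
      by (intro tendsto_mult_right_zero tendsto_norm_zero[OF tendsto_ident_at])
    show "\<forall>\<^sub>F h in at 0. norm (g (z + h) - g z - F h) / norm h \<le> K * norm h"
      unfolding eventually_at
    proof (intro exI[of _ \<delta>] conjI ballI impI)
      fix h :: 'a assume "h \<noteq> 0 \<and> dist h 0 < \<delta>"
      then show "norm (g (z + h) - g z - F h) / norm h \<le> K * norm h"
        using rem[of h] by (simp add: divide_le_eq power2_eq_square mult.assoc)
    qed fact
  qed simp
qed fact

lemma has_sum_diff:
  fixes f g :: "'a \<Rightarrow> 'b::topological_ab_group_add"
  assumes "(f has_sum a) A" "(g has_sum b) A"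
  shows "((\<lambda>x. f x - g x) has_sum (a - b)) A"
  using has_sum_add[OF assms(1), of "\<lambda>x. - g x" "- b"] assms(2) by (simp add: has_sum_uminus)

text \<open>Derivatives and second-order remainders of the terms are bounded by multiples of
  \<open>M i\<close>, with factors that do not depend on \<open>i\<close>. Both can therefore be
  summed, and the sum of the derivatives is the derivative of the sum.\<close>

lemma holo_on_infsum:
  fixes g :: "'i \<Rightarrow> complex^'n \<Rightarrow> complex"
  assumes "open D" and hol: "\<And>i. i \<in> I \<Longrightarrow> holo_on (*) (g i) D"
    and bound: "\<And>i z. i \<in> I \<Longrightarrow> z \<in> D \<Longrightarrow> norm (g i z) \<le> M i" and M: "M summable_on I"
  shows "holo_on (*) (\<lambda>z. \<Sum>\<^sub>\<infinity>i\<in>I. g i z) D"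
  unfolding holo_on_alt
proof
  fix z assume z: "z \<in> D"
  obtain \<delta> where \<delta>: "0 < \<delta>" "ball z \<delta> \<subseteq> D"
    using \<open>open D\<close> z open_contains_ball by blast
  have "\<forall>i\<in>I. \<exists>f'. (g i has_derivative f') (at z) \<and> (\<forall>a x. f' (a *s x) = a * f' x)"
    using hol z unfolding holo_on_alt by blast
  then obtain F where F: "\<And>i. i \<in> I \<Longrightarrow> (g i has_derivative F i) (at z)"
    "\<And>i a x. i \<in> I \<Longrightarrow> F i (a *s x) = a * F i x" by metis
  have bF: "norm (F i h) \<le> 2 * M i / \<delta> * norm h" if "i \<in> I" for i h
    by (rule holo_on_derivative_bounds(1)[OF hol[OF that] \<delta>(2,1) bound[OF that] F(1)[OF that] F(2)[OF that]])
  have rem: "norm (g i (z + h) - g i z - F i h) \<le> 4 * M i / \<delta>\<^sup>2 * (norm h)\<^sup>2"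
    if "i \<in> I" "norm h < \<delta>" for i h
    by (rule holo_on_derivative_bounds(2)[OF hol[OF that(1)] \<delta>(2,1) bound[OF that(1)] F(1)[OF that(1)] F(2)[OF that(1)] that(2)])
  have sM: "((\<lambda>i. K * M i) has_sum (K * (\<Sum>\<^sub>\<infinity>i\<in>I. M i))) I" for K
    by (intro has_sum_cmult_right has_sum_infsum M)
  have summ: "f summable_on I" if "\<And>i. i \<in> I \<Longrightarrow> norm (f i) \<le> K * M i" for f :: "'i \<Rightarrow> complex" and K
    using Infinite_Sum.abs_summable_on_comparison_test'[OF has_sum_imp_summable[OF sM[of K]] that]
    by (rule abs_summable_summable)
  have sF: "(\<lambda>i. F i h) summable_on I" for h
    by (rule summ[of _ "2 / \<delta> * norm h"]) (use bF in \<open>simp add: mult_ac\<close>)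
  have sg: "(\<lambda>i. g i x) summable_on I" if "x \<in> D" for x
    by (rule summ[of _ 1]) (use bound that in simp)
  define G where "G h = (\<Sum>\<^sub>\<infinity>i\<in>I. F i h)" for h
  have G_scale: "G (a *s x) = a * G x" for a x
  proof -
    have "G (a *s x) = (\<Sum>\<^sub>\<infinity>i\<in>I. a * F i x)"
      unfolding G_def by (rule infsum_cong) (simp add: F(2))
    then show ?thesis by (simp add: G_def infsum_cmult_right')
  qed
  have "bounded_linear G"
  proof (rule bounded_linear_intro)
    show "G (x + y) = G x + G y" for x y
    proof -
      have "G (x + y) = (\<Sum>\<^sub>\<infinity>i\<in>I. F i x + F i y)"
        unfolding G_def by (rule infsum_cong) (use F(1) has_derivative_linear linear_add in blast)
      then show ?thesis by (simp add: G_def infsum_add sF)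
    qed
    show "G (t *\<^sub>R x) = t *\<^sub>R G x" for t x
    proof -
      have "t *\<^sub>R x = complex_of_real t *s x"
        unfolding Finite_Cartesian_Product.vec_eq_iff vector_scaleR_component vector_smult_component
        by (simp add: scaleR_conv_of_real)
      then show ?thesis using G_scale[of "complex_of_real t" x] by (simp add: scaleR_conv_of_real)
    qed
    show "norm (G x) \<le> norm x * (2 / \<delta> * (\<Sum>\<^sub>\<infinity>i\<in>I. M i))" for x
    proof -
      have "norm (G x) \<le> (2 / \<delta> * norm x) * (\<Sum>\<^sub>\<infinity>i\<in>I. M i)"
        unfolding G_def
        by (rule norm_infsum_le[OF has_sum_infsum[OF sF] sM]) (use bF in \<open>simp add: mult_ac\<close>)
      then show ?thesis by (simp add: mult_ac)
    qed
  qed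
  moreover have "norm ((\<Sum>\<^sub>\<infinity>i\<in>I. g i (z + h)) - (\<Sum>\<^sub>\<infinity>i\<in>I. g i z) - G h) \<le>
      (4 / \<delta>\<^sup>2 * (\<Sum>\<^sub>\<infinity>i\<in>I. M i)) * (norm h)\<^sup>2" if "norm h < \<delta>" for h
  proof -
    have "z + h \<in> D" using \<delta> that by (auto simp: dist_norm)
    have "((\<lambda>i. g i (z + h) - g i z - F i h) has_sum
        ((\<Sum>\<^sub>\<infinity>i\<in>I. g i (z + h)) - (\<Sum>\<^sub>\<infinity>i\<in>I. g i z) - G h)) I"
      unfolding G_def by (intro has_sum_diff has_sum_infsum sg sF z \<open>z + h \<in> D\<close>)
    then have "norm ((\<Sum>\<^sub>\<infinity>i\<in>I. g i (z + h)) - (\<Sum>\<^sub>\<infinity>i\<in>I. g i z) - G h) \<le>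
      (4 / \<delta>\<^sup>2 * (norm h)\<^sup>2) * (\<Sum>\<^sub>\<infinity>i\<in>I. M i)"
      by (rule norm_infsum_le[OF _ sM]) (use rem that in \<open>simp add: mult_ac\<close>)
    then show ?thesis by (simp add: mult_ac)
  qed
  ultimately have "((\<lambda>z. \<Sum>\<^sub>\<infinity>i\<in>I. g i z) has_derivative G) (at z)"
    using \<delta>(1) by (intro has_derivative_quadratic_remainder)
  then show "\<exists>f'. ((\<lambda>z. \<Sum>\<^sub>\<infinity>i\<in>I. g i z) has_derivative f') (at z) \<and> (\<forall>a x. f' (a *s x) = a * f' x)"
    using G_scale by blast
qed

lemma holo_on_cong:
  assumes "open D" "holo_on (*) f D" "\<And>z. z \<in> D \<Longrightarrow> g z = f z"
  shows "holo_on (*) g D"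
  unfolding holo_on_alt
proof
  fix z assume z: "z \<in> D"
  then obtain f' where "(f has_derivative f') (at z)" "\<forall>a x. f' (a *s x) = a * f' x"
    using assms(2) unfolding holo_on_alt by blast
  moreover from this(1) have "(g has_derivative f') (at z)"
    by (rule has_derivative_transform_within_open[OF _ assms(1) z]) (simp add: assms(3))
  ultimately show "\<exists>f'. (g has_derivative f') (at z) \<and> (\<forall>a x. f' (a *s x) = a * f' x)" by blast
qed

lemma holo_on_mult:
  assumes "holo_on (*) f D" "holo_on (*) g D"
  shows "holo_on (*) (\<lambda>z. f z * g z) D"
  unfolding holo_on_alt
proof
  fix z assume "z \<in> D"
  then obtain f' g' where "(f has_derivative f') (at z)" "\<forall>a x. f' (a *s x) = a * f' x"
      "(g has_derivative g') (at z)" "\<forall>a x. g' (a *s x) = a * g' x"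
    using assms unfolding holo_on_alt by blast
  then show "\<exists>h'. ((\<lambda>z. f z * g z) has_derivative h') (at z) \<and> (\<forall>a x. h' (a *s x) = a * h' x)"
    by (intro exI[of _ "\<lambda>h. f z * g' h + f' h * g z"]) (auto intro!: has_derivative_mult simp: algebra_simps)
qed

lemma holo_on_const: "holo_on (*) (\<lambda>_. a) D"
  unfolding holo_on_alt by (intro ballI exI[of _ "\<lambda>_. 0"]) auto

lemma holo_on_add:
  assumes "holo_on (*) f D" "holo_on (*) g D"
  shows "holo_on (*) (\<lambda>z. f z + g z) D"
  unfolding holo_on_alt
proof
  fix z assume "z \<in> D"
  then obtain f' g' where "(f has_derivative f') (at z)" "\<forall>a x. f' (a *s x) = a * f' x"
      "(g has_derivative g') (at z)" "\<forall>a x. g' (a *s x) = a * g' x"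
    using assms unfolding holo_on_alt by blast
  then show "\<exists>h'. ((\<lambda>z. f z + g z) has_derivative h') (at z) \<and> (\<forall>a x. h' (a *s x) = a * h' x)"
    by (intro exI[of _ "\<lambda>h. f' h + g' h"]) (auto intro!: has_derivative_add simp: algebra_simps)
qed

lemma holo_on_compose:
  assumes "holo_on (*) f E" "holo_on (*s) g D" "\<And>z. z \<in> D \<Longrightarrow> g z \<in> E"
  shows "holo_on (*) (\<lambda>z. f (g z)) D"
  unfolding holo_on_alt
proof
  fix z assume z: "z \<in> D"
  then obtain g' where g': "(g has_derivative g') (at z)" "\<forall>a x. g' (a *s x) = a *s g' x"
    using assms(2) unfolding holo_on_vector_alt by blast
  obtain f' where f': "(f has_derivative f') (at (g z))" "\<forall>a x. f' (a *s x) = a * f' x"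
    using assms(1) assms(3)[OF z] unfolding holo_on_alt by blast
  show "\<exists>h'. ((\<lambda>z. f (g z)) has_derivative h') (at z) \<and> (\<forall>a x. h' (a *s x) = a * h' x)"
    using has_derivative_compose[OF g'(1) f'(1)] g'(2) f'(2) by (intro exI[of _ "\<lambda>h. f' (g' h)"]) auto
qed

lemma U_space_subspace: "cfun.subspace (U_space D)"
proof (rule cfun.subspaceI)
  show "0 \<in> U_space D"
    using holo_on_const[of 0 D] by (simp add: U_space_def in_U_def zero_fun_def)
next
  fix f g assume "f \<in> U_space D" "g \<in> U_space D"
  then show "f + g \<in> U_space D"
    using holo_on_add[of f D g] by (auto simp: U_space_def in_U_def plus_fun_def intro!: continuous_intros)
next
  fix f a assume "f \<in> U_space D"
  then show "fscale a f \<in> U_space D"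
    using holo_on_mult[OF holo_on_const[of a D], of f]
    by (auto simp: U_space_def in_U_def fscale_def intro!: continuous_intros)
qed

section \<open>Sums of monomial degrees\<close>

text \<open>By the mean value theorem the left-hand side grows from \<open>n\<close> to
  \<open>n + 1\<close> by at most the new term of the sum. Strictness comes from the term
  \<open>k = 0\<close>, where \<open>1 / (1 + p) < 1\<close>; it is the source of the strict
  inequality in the final bound.\<close>

lemma sum_powr_lower_bound:
  fixes p :: real
  assumes "0 < p" "1 \<le> n"
  shows "real n powr (1 + p) / (1 + p) < (\<Sum>k<n. real (Suc k) powr p)"
  using \<open>1 \<le> n\<close>
proof (induction n rule: dec_induct)
  case base
  show ?case using \<open>0 < p\<close> by simp
next
  case (step n)
  have "\<exists>z>real n. z < real (Suc n) \<and> real (Suc n) powr (1 + p) - real n powr (1 + p) =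
      (real (Suc n) - real n) * ((1 + p) * z powr p)"
  proof (rule MVT2)
    fix x assume "real n \<le> x" "x \<le> real (Suc n)"
    then have "0 < x" using step by simp
    then show "((\<lambda>x. x powr (1 + p)) has_real_derivative (1 + p) * x powr p) (at x)"
      by (auto intro!: derivative_eq_intros)
  qed simp
  then obtain z where z: "real n < z" "z < real (Suc n)"
    "real (Suc n) powr (1 + p) - real n powr (1 + p) = (1 + p) * z powr p" by auto
  have "z powr p \<le> real (Suc n) powr p"
    using z \<open>0 < p\<close> by (intro powr_mono2) auto
  then have "real (Suc n) powr (1 + p) - real n powr (1 + p) \<le> (1 + p) * real (Suc n) powr p"
    unfolding z(3) using \<open>0 < p\<close> by (intro mult_left_mono) auto
  then have "real (Suc n) powr (1 + p) / (1 + p) \<le>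
      (real n powr (1 + p) + (1 + p) * real (Suc n) powr p) / (1 + p)"
    using \<open>0 < p\<close> by (intro divide_right_mono) auto
  also have "\<dots> = real n powr (1 + p) / (1 + p) + real (Suc n) powr p"
    using \<open>0 < p\<close> by (simp add: add_divide_distrib)
  finally have "real (Suc n) powr (1 + p) / (1 + p) \<le> real n powr (1 + p) / (1 + p) + real (Suc n) powr p" .
  then show ?case using step by simp
qed

text \<open>
  The degree of the monomial with index \<open>k\<close> (starting from \<open>0\<close>) when the monomials in \<open>d\<close>
  variables are listed by increasing degree.
\<close>

definition monomial_degree :: "nat \<Rightarrow> nat \<Rightarrow> nat" where
  "monomial_degree d k = (LEAST m. k < (m + d) choose d)"

text \<open>Since \<open>(m + d) choose d\<close> counts the monomials of degree at most
  \<open>m\<close>, minimality says that at most \<open>k\<close> monomials have degree below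
  \<open>monomial_degree d k\<close>. So at most \<open>k\<close> linear conditions are needed to
  force that order of vanishing.\<close>

lemma monomial_degree_properties:
  assumes "1 \<le> d"
  shows "k < (monomial_degree d k + d) choose d"
    and "(d + monomial_degree d k - 1) choose d \<le> k"
proof -
  obtain e where e: "d = Suc e" using assms by (cases d) auto
  have "k < (k + d) choose d"
  proof (induction k)
    case (Suc k)
    have "0 < Suc (k + e) choose e" by simp
    then show ?case using Suc unfolding e add_Suc_right add_Suc binomial_Suc_Suc by linarith
  qed simp
  then show *: "k < (monomial_degree d k + d) choose d"
    unfolding monomial_degree_def by (rule LeastI)
  show "(d + monomial_degree d k - 1) choose d \<le> k"
  proof (cases "monomial_degree d k")
    case 0
    then show ?thesis using assms by (simp add: binomial_eq_0)
  next
    case (Suc m)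
    then have "\<not> k < (m + d) choose d"
      using not_less_Least[of m "\<lambda>m. k < (m + d) choose d"] by (simp add: monomial_degree_def)
    then show ?thesis using Suc by (simp add: add.commute)
  qed
qed

text \<open>The product \<open>(m + 1) ... (m + d)\<close> is replaced by
  \<open>(m + d) ^ d\<close>; after taking roots this crude step costs the shift by
  \<open>d\<close>.\<close>

lemma monomial_degree_lower_bound:
  assumes "1 \<le> d"
  shows "fact d powr (1 / real d) * real (Suc k) powr (1 / real d) - real d \<le> real (monomial_degree d k)"
proof -
  let ?m = "monomial_degree d k"
  have "Suc k * fact d \<le> ((?m + d) choose d) * fact d"
    using monomial_degree_properties(1)[OF assms, of k] by (intro mult_right_mono) auto
  also have "\<dots> \<le> (?m + d) ^ d" by (rule binomial_fact_pow)
  finally have "real (Suc k * fact d) \<le> real ((?m + d) ^ d)" by (rule of_nat_mono)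
  then have "fact d * real (Suc k) \<le> real (?m + d) ^ d"
    by (simp only: of_nat_mult of_nat_power of_nat_fact mult.commute)
  then have "(fact d * real (Suc k)) powr (1 / real d) \<le> (real (?m + d) ^ d) powr (1 / real d)"
    by (intro powr_mono2) auto
  also have "(real (?m + d) ^ d) powr (1 / real d) = real (?m + d)"
    using assms by (simp add: powr_realpow[symmetric] powr_powr)
  finally show ?thesis by (simp add: powr_mult)
qed

text \<open>With \<open>p = 1 / d\<close> the integral comparison yields
  \<open>1 / (1 + p) = d / (d + 1)\<close>. The quotient by \<open>n\<close> is the exponent of
  \<open>r\<close> that remains after an \<open>n\<close>-th root.\<close>

lemma sum_monomial_degree_lower_bound:
  assumes "1 \<le> d" "1 \<le> n"
  shows "real d / (real d + 1) * fact d powr (1 / real d) * real n powr (1 / real d) - real d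
    < real (\<Sum>k<n. monomial_degree d k) / real n"
proof -
  let ?p = "1 / real d"
  have p: "0 < ?p" using assms by simp
  have "real n * (real d / (real d + 1) * fact d powr ?p * real n powr ?p - real d) =
      fact d powr ?p * (real n powr (1 + ?p) / (1 + ?p)) - real n * real d"
  proof -
    have "real n powr (1 + ?p) = real n * real n powr ?p"
      using assms by (simp only: powr_add) simp
    moreover have "1 + ?p = (real d + 1) / real d" using assms by (simp add: field_simps)
    then have "a / (1 + ?p) = a * (real d / (real d + 1))" for a by simp
    ultimately show ?thesis by (simp only:) (simp add: algebra_simps)
  qed
  also have "\<dots> < fact d powr ?p * (\<Sum>k<n. real (Suc k) powr ?p) - real n * real d"
    using sum_powr_lower_bound[OF p assms(2)] by (intro diff_strict_right_mono mult_strict_left_mono) auto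
  also have "\<dots> = (\<Sum>k<n. fact d powr ?p * real (Suc k) powr ?p - real d)"
    by (simp add: sum_subtractf sum_distrib_left)
  also have "\<dots> \<le> (\<Sum>k<n. real (monomial_degree d k))"
    by (intro sum_mono monomial_degree_lower_bound assms)
  finally show ?thesis using assms by (simp add: field_simps)
qed

text \<open>
  Both entries of the minimum are at least \<open>1\<close>; the estimate holds without this factor.
\<close>

lemma eigenvalue_bound_arithmetic:
  fixes x W r :: real
  assumes d: "1 \<le> d" and n: "1 \<le> n" and r: "0 < r" "r < 1" and "0 < W" "0 \<le> x"
    and bound: "x ^ n \<le> W ^ n * r ^ (\<Sum>k<n. monomial_degree d k)"
  shows "x < min (real n powr (1/2))
               (sqrt (real d) / (1 - r\<^sup>2) powr (real d / 2)
                  * real n powr ((real d - 1) / (2 * real d)))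
           * (W / r ^ d)
           * r powr (real d / (real d + 1) * (fact d) powr (1 / real d) * real n powr (1 / real d))"
proof -
  let ?S = "\<Sum>k<n. monomial_degree d k"
  let ?e = "real d / (real d + 1) * fact d powr (1 / real d) * real n powr (1 / real d)"
  have "(W * r powr (real ?S / real n)) ^ n = W ^ n * r powr real ?S"
    using n r by (simp add: power_mult_distrib powr_power)
  also have "\<dots> = W ^ n * r ^ ?S" using r by (simp only: powr_realpow)
  finally have "x ^ n \<le> (W * r powr (real ?S / real n)) ^ n" using bound by simp
  then have "x \<le> W * r powr (real ?S / real n)"
    using n \<open>0 < W\<close> r by (subst (asm) power_mono_iff) (use \<open>0 \<le> x\<close> in auto)
  also have "\<dots> < W * r powr (?e - real d)"
    using sum_monomial_degree_lower_bound[OF d n] r \<open>0 < W\<close>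
    by (intro mult_strict_left_mono powr_less_mono') auto
  also have "\<dots> = 1 * (W / r ^ d) * r powr ?e"
    using r by (simp add: powr_diff powr_realpow)
  also have "\<dots> \<le> min (real n powr (1/2))
               (sqrt (real d) / (1 - r\<^sup>2) powr (real d / 2)
                  * real n powr ((real d - 1) / (2 * real d))) * (W / r ^ d) * r powr ?e"
  proof (intro mult_right_mono)
    have "1 \<le> real n powr (1/2)" using n by (intro ge_one_powr_ge_zero) auto
    moreover have "1 \<le> real n powr ((real d - 1) / (2 * real d))"
      using n d by (intro ge_one_powr_ge_zero) auto
    moreover have "1 \<le> sqrt (real d) / (1 - r\<^sup>2) powr (real d / 2)"
    proof -
      have "0 < 1 - r\<^sup>2" using r by (simp add: power_less_one_iff abs_square_less_1)
      moreover have "1 - r\<^sup>2 \<le> 1" by simp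
      ultimately have "(1 - r\<^sup>2) powr (real d / 2) \<le> 1" "0 < (1 - r\<^sup>2) powr (real d / 2)"
        by (auto intro!: powr_le1)
      moreover have "1 \<le> sqrt (real d)" using d by simp
      ultimately show ?thesis by (simp only: le_divide_eq if_True)
    qed
    ultimately show "1 \<le> min (real n powr (1/2))
               (sqrt (real d) / (1 - r\<^sup>2) powr (real d / 2)
                  * real n powr ((real d - 1) / (2 * real d)))"
      using mult_mono[of 1 "sqrt (real d) / (1 - r\<^sup>2) powr (real d / 2)" 1] by simp
  qed (use \<open>0 < W\<close> r in auto)
  finally show ?thesis .
qed

section \<open>The transfer operator on a ball\<close>

text \<open>The sum of the moduli of the coordinates is at most \<open>\<rho> * CARD('d)\<close>;
  the extra \<open>1\<close> makes the inequality strict.\<close>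

lemma polydisc_norm_less:
  fixes x :: "complex^'d"
  assumes "x \<in> polydisc \<rho>" "0 < \<rho>"
  shows "norm x < \<rho> * real (CARD('d) + 1)"
proof -
  have "norm x \<le> (\<Sum>i\<in>UNIV. norm (x $ i))"
    unfolding Finite_Cartesian_Product.norm_vec_def by (rule L2_set_le_sum) simp
  also have "\<dots> \<le> (\<Sum>i\<in>(UNIV::'d set). \<rho>)"
    using assms by (intro sum_mono) (auto simp: polydisc_def intro: less_imp_le)
  finally show ?thesis using assms by (simp add: algebra_simps)
qed

lemma depends_on_UNIV: "f \<in> depends_on \<rho> UNIV"
  by (simp add: depends_on_def)

text \<open>Off the polydisc \<open>norm x\<close> is at least \<open>\<rho>\<close>, so boundedness
  alone gives an estimate of order \<open>m\<close> there, with constant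
  \<open>abs M / \<rho> ^ m\<close>.\<close>

lemma vanishes_to_bounded_extension:
  fixes f :: "complex^'d \<Rightarrow> complex"
  assumes "vanishes_to \<rho> m f" "0 < \<rho>" "\<And>x. norm x \<le> R \<Longrightarrow> norm (f x) \<le> M"
  shows "\<exists>C\<ge>0. \<forall>x. norm x \<le> R \<longrightarrow> norm (f x) \<le> C * norm x ^ m"
proof -
  obtain C where C: "C \<ge> 0" "\<And>x. x \<in> polydisc \<rho> \<Longrightarrow> norm (f x) \<le> C * norm x ^ m"
    using assms(1) unfolding vanishes_to_def by blast
  let ?C = "C + \<bar>M\<bar> / \<rho> ^ m"
  have "norm (f x) \<le> ?C * norm x ^ m" if x: "norm x \<le> R" for x
  proof (cases "x \<in> polydisc \<rho>")
    case True
    have "0 \<le> \<bar>M\<bar> / \<rho> ^ m * norm x ^ m" using assms(2) by simp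
    then show ?thesis using C(2)[OF True] by (simp add: distrib_right)
  next
    case False
    then obtain i where "\<rho> \<le> norm (x $ i)" by (auto simp: polydisc_def not_less)
    then have "\<rho> \<le> norm x" using Finite_Cartesian_Product.norm_nth_le[of x i] by linarith
    then have "\<rho> ^ m \<le> norm x ^ m" using assms(2) by (intro power_mono) auto
    then have "\<bar>M\<bar> / \<rho> ^ m * \<rho> ^ m \<le> \<bar>M\<bar> / \<rho> ^ m * norm x ^ m"
      using assms(2) by (intro mult_left_mono) auto
    then have "\<bar>M\<bar> \<le> \<bar>M\<bar> / \<rho> ^ m * norm x ^ m" using assms(2) by simp
    moreover have "norm (f x) \<le> \<bar>M\<bar>" using assms(3)[OF x] by linarith
    moreover have "0 \<le> C * norm x ^ m" using C(1) by simp
    ultimately show ?thesis by (simp only: distrib_right)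
  qed
  moreover have "?C \<ge> 0" using C(1) assms(2) by simp
  ultimately show ?thesis by blast
qed

lemma (in linear_endo) map_combination:
  fixes n :: nat
  assumes "\<And>j. j < n \<Longrightarrow> f j \<in> V" "\<And>z. x z = (\<Sum>j<n. q j * f j z)"
  shows "x \<in> V \<and> L x z = (\<Sum>j<n. q j * L (f j) z)"
  using assms
proof (induction n arbitrary: x z)
  case 0
  then have "x = 0" by (simp add: fun_eq_iff)
  moreover have "L 0 z = 0" by (simp only: map_0) simp
  ultimately show ?case using cfun.subspace_0[OF V] by (simp only: lessThan_0 sum.empty simp_thms)
next
  case (Suc n)
  let ?y = "\<lambda>z. \<Sum>j<n. q j * f j z"
  have y: "?y \<in> V" "\<And>z. L ?y z = (\<Sum>j<n. q j * L (f j) z)" using Suc.IH[of ?y] Suc.prems(1) by auto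
  have "x = fscale (q n) (f n) + ?y" using Suc.prems(2) by (simp add: fscale_def fun_eq_iff)
  moreover have "fscale (q n) (f n) + ?y \<in> V"
    using Suc.prems(1)[of n] y(1) by (intro cfun.subspace_add[OF V] cfun.subspace_scale[OF V]) auto
  moreover have "L (fscale (q n) (f n) + ?y) = fscale (q n) (L (f n)) + L ?y"
    by (rule lin[OF Suc.prems(1)[OF lessI] y(1)])
  then have "L (fscale (q n) (f n) + ?y) z = q n * L (f n) z + L ?y z"
    by (simp only:) (simp add: fscale_def)
  ultimately show ?case by (simp only: y(2) sum.lessThan_Suc) (simp add: add.commute)
qed

locale ball_system =
  fixes c :: "complex^'d" and R r W :: real and D :: "(complex^'d) set" and I :: "'i set"
    and T :: "'i \<Rightarrow> complex^'d \<Rightarrow> complex^'d" and w :: "'i \<Rightarrow> complex^'d \<Rightarrow> complex"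
  assumes R: "0 < R" and r: "0 < r" "r < 1" and D: "D = ball c R"
    and T: "\<And>i. i \<in> I \<Longrightarrow> in_U (*s) D (T i)" and w: "\<And>i. i \<in> I \<Longrightarrow> in_U (*) D (w i)"
    and w_summable: "(\<lambda>i. U_norm D (w i)) summable_on I"
    and T_ball: "\<And>i z. i \<in> I \<Longrightarrow> z \<in> D \<Longrightarrow> T i z \<in> ball c (r * R)"
    and W: "W = (SUP z\<in>D. \<Sum>\<^sub>\<infinity>i\<in>I. norm (w i z))"
begin

abbreviation "K \<equiv> cball c R"

lemma closure_D: "closure D = K"
  using R by (simp add: D)

lemma open_D: "open D"
  by (simp add: D)

lemma rR_less: "r * R < R"
  using R r by simp

text \<open>The range of \<open>T i\<close> is prescribed on the open ball only, while suprema are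
  taken over \<open>K\<close>. By continuity boundary points go into the closed ball of radius
  \<open>r * R\<close>, which still lies inside \<open>D\<close>.\<close>

lemma T_cball: "i \<in> I \<Longrightarrow> z \<in> K \<Longrightarrow> T i z \<in> cball c (r * R)"
proof -
  assume i: "i \<in> I" and z: "z \<in> K"
  have "T i ` closure D \<subseteq> cball c (r * R)"
  proof (rule image_closure_subset)
    show "continuous_on (closure D) (T i)" using T[OF i] by (simp add: in_U_def)
    show "T i ` D \<subseteq> cball c (r * R)" using T_ball[OF i] by fastforce
  qed simp
  then show ?thesis using z closure_D by (metis image_subset_iff)
qed

lemma T_D: "i \<in> I \<Longrightarrow> z \<in> K \<Longrightarrow> T i z \<in> D"
  using T_cball[of i z] rR_less by (auto simp: D)

lemma continuous_K_bound:
  assumes "continuous_on K (f :: complex^'d \<Rightarrow> complex)"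
  obtains M where "0 \<le> M" "\<And>z. z \<in> K \<Longrightarrow> norm (f z) \<le> M"
proof -
  have "bounded (f ` K)" by (intro compact_imp_bounded compact_continuous_image assms compact_cball)
  then obtain M where "0 < M" "\<forall>x\<in>f ` K. norm x \<le> M" unfolding bounded_pos by blast
  then show ?thesis using that[of M] by auto
qed

lemma w_le: "i \<in> I \<Longrightarrow> z \<in> K \<Longrightarrow> norm (w i z) \<le> U_norm D (w i)"
proof -
  assume i: "i \<in> I" and z: "z \<in> K"
  then have "continuous_on K (w i)" using w[OF i] by (simp add: in_U_def closure_D)
  then obtain M where "\<And>z. z \<in> K \<Longrightarrow> norm (w i z) \<le> M" by (rule continuous_K_bound) (rule that)
  then show ?thesis
    unfolding U_norm_def closure_D using z by (intro cSUP_upper bdd_aboveI2)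
qed

lemma w_abs_summable: "z \<in> K \<Longrightarrow> (\<lambda>i. norm (w i z)) summable_on I"
  using Infinite_Sum.abs_summable_on_comparison_test'[OF w_summable w_le] by simp

text \<open>\<open>W\<close> is a supremum over the open ball. The sum of moduli is a uniform limit
  of continuous functions on \<open>K\<close>, so the bound extends to the boundary.\<close>

lemma w_sum_le_W:
  assumes "z \<in> K"
  shows "(\<Sum>\<^sub>\<infinity>i\<in>I. norm (w i z)) \<le> W"
proof -
  let ?g = "\<lambda>z. \<Sum>\<^sub>\<infinity>i\<in>I. norm (w i z)"
  have cont: "continuous_on K ?g"
  proof (rule uniform_limit_theorem)
    show "uniform_limit K (\<lambda>X z. \<Sum>i\<in>X. norm (w i z)) ?g (finite_subsets_at_top I)"
      by (rule Weierstrass_m_test_general[OF _ w_summable]) (use w_le in auto)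
    show "\<forall>\<^sub>F X in finite_subsets_at_top I. continuous_on K (\<lambda>z. \<Sum>i\<in>X. norm (w i z))"
      by (rule eventually_finite_subsets_at_top_weakI)
         (use w in \<open>auto simp: in_U_def closure_D intro!: continuous_intros\<close>)
  qed simp
  have bdd: "?g z \<le> (\<Sum>\<^sub>\<infinity>i\<in>I. U_norm D (w i))" if "z \<in> K" for z
    by (intro infsum_mono w_abs_summable[OF that] w_summable w_le that)
  have "?g z \<le> W" if "z \<in> D" for z
    unfolding W by (rule cSUP_upper[OF that]) (rule bdd_aboveI2, rule bdd, simp add: D)
  then show ?thesis
    using continuous_le_on_closure[of D ?g z W] cont assms by (simp add: closure_D)
qed

lemma U_space_continuous: "f \<in> U_space D \<Longrightarrow> continuous_on K f"
  by (simp add: U_space_def in_U_def closure_D)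

lemma term_bound:
  assumes "\<And>z. z \<in> K \<Longrightarrow> norm (f z) \<le> M" "i \<in> I" "z \<in> K"
  shows "norm (w i z * f (T i z)) \<le> M * U_norm D (w i)"
proof -
  have "T i z \<in> K" using T_D[OF assms(2,3)] by (simp add: D)
  then have "norm (w i z) * norm (f (T i z)) \<le> U_norm D (w i) * M"
    using w_le[OF assms(2,3)] order_trans[OF norm_ge_zero w_le[OF assms(2,3)]]
    by (intro mult_mono assms(1)) auto
  then show ?thesis by (simp add: norm_mult mult.commute)
qed

lemma transfer_op_has_sum:
  assumes "f \<in> U_space D" "z \<in> K"
  shows "((\<lambda>i. w i z * f (T i z)) has_sum transfer_op D I T w f z) I"
proof -
  obtain M where M: "\<And>z. z \<in> K \<Longrightarrow> norm (f z) \<le> M"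
    by (rule continuous_K_bound[OF U_space_continuous[OF assms(1)]]) (rule that)
  have "(\<lambda>i. norm (w i z * f (T i z))) summable_on I"
    by (rule Infinite_Sum.abs_summable_on_comparison_test'[where g="\<lambda>i. M * U_norm D (w i)"])
       (use term_bound[OF M _ assms(2)] w_summable in \<open>auto intro: summable_on_cmult_right\<close>)
  then have "(\<lambda>i. w i z * f (T i z)) summable_on I" by (rule abs_summable_summable)
  then show ?thesis using assms(2) by (simp add: transfer_op_def closure_D)
qed

text \<open>One summable majorant, \<open>M * U_norm D (w i)\<close>, gives both uniform convergence
  on \<open>K\<close>, hence continuity, and termwise differentiation on \<open>D\<close>.\<close>

lemma transfer_op_U_space:
  assumes f: "f \<in> U_space D"
  shows "transfer_op D I T w f \<in> U_space D"
proof -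
  obtain M where M: "\<And>z. z \<in> K \<Longrightarrow> norm (f z) \<le> M"
    by (rule continuous_K_bound[OF U_space_continuous[OF f]]) (rule that)
  let ?g = "\<lambda>z. \<Sum>\<^sub>\<infinity>i\<in>I. w i z * f (T i z)"
  have sM: "(\<lambda>i. M * U_norm D (w i)) summable_on I" by (intro summable_on_cmult_right w_summable)
  have "continuous_on K ?g"
  proof (rule uniform_limit_theorem)
    show "uniform_limit K (\<lambda>X z. \<Sum>i\<in>X. w i z * f (T i z)) ?g (finite_subsets_at_top I)"
      by (rule Weierstrass_m_test_general[OF _ sM]) (use term_bound[OF M] in auto)
    have "continuous_on K (\<lambda>z. w i z * f (T i z))" if "i \<in> I" for i
    proof (intro continuous_on_mult continuous_on_compose2[OF U_space_continuous[OF f]])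
      show "continuous_on K (w i)" "continuous_on K (T i)"
        using w[OF that] T[OF that] by (simp_all add: in_U_def closure_D)
      show "T i ` K \<subseteq> K" using T_D[OF that] D by fastforce
    qed
    then show "\<forall>\<^sub>F X in finite_subsets_at_top I. continuous_on K (\<lambda>z. \<Sum>i\<in>X. w i z * f (T i z))"
      by (intro eventually_finite_subsets_at_top_weakI continuous_on_sum) auto
  qed simp
  then have "continuous_on K (transfer_op D I T w f)"
    by (rule continuous_on_eq) (simp add: transfer_op_def closure_D)
  moreover have "holo_on (*) (transfer_op D I T w f) D"
  proof (rule holo_on_cong[OF open_D])
    show "holo_on (*) ?g D"
    proof (rule holo_on_infsum[OF open_D])
      fix i assume i: "i \<in> I"
      show "holo_on (*) (\<lambda>z. w i z * f (T i z)) D"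
      proof (rule holo_on_mult[OF _ holo_on_compose])
        show "holo_on (*) (w i) D" "holo_on (*s) (T i) D" "holo_on (*) f D"
          using w[OF i] T[OF i] f by (simp_all add: in_U_def U_space_def)
        show "T i z \<in> D" if "z \<in> D" for z
          by (rule T_D[OF i]) (use that in \<open>simp add: D\<close>)
      qed
    next
      fix i z assume "i \<in> I" "z \<in> D"
      then show "norm (w i z * f (T i z)) \<le> M * U_norm D (w i)"
        by (intro term_bound[OF M]) (auto simp: D)
    qed (rule sM)
    fix z assume "z \<in> D"
    then have "z \<in> K" by (simp add: D)
    then show "transfer_op D I T w f z = ?g z" by (simp add: transfer_op_def closure_D)
  qed
  ultimately show ?thesis by (simp add: U_space_def in_U_def closure_D transfer_op_def)
qed

text \<open>An infinite sum splits reliably only when its parts are summable, so linearity is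
  claimed on \<open>U_space D\<close> and not for all functions.\<close>

lemma transfer_op_linear_endo: "linear_endo (U_space D) (transfer_op D I T w)"
proof
  show "cfun.subspace (U_space D)" by (rule U_space_subspace)
  show "transfer_op D I T w f \<in> U_space D" if "f \<in> U_space D" for f
    using that by (rule transfer_op_U_space)
  fix f g a assume fg: "f \<in> U_space D" "g \<in> U_space D"
  show "transfer_op D I T w (fscale a f + g) = fscale a (transfer_op D I T w f) + transfer_op D I T w g"
  proof
    fix z
    show "transfer_op D I T w (fscale a f + g) z = (fscale a (transfer_op D I T w f) + transfer_op D I T w g) z"
    proof (cases "z \<in> K")
      case True
      have "((\<lambda>i. a * (w i z * f (T i z)) + w i z * g (T i z)) has_sum
          (a * transfer_op D I T w f z + transfer_op D I T w g z)) I"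
        by (intro has_sum_add has_sum_cmult_right transfer_op_has_sum fg True)
      moreover have "(\<lambda>i. a * (w i z * f (T i z)) + w i z * g (T i z)) =
          (\<lambda>i. w i z * (fscale a f + g) (T i z))"
        by (simp add: fscale_def fun_eq_iff algebra_simps)
      moreover have "fscale a f + g \<in> U_space D"
        using fg by (intro cfun.subspace_add[OF U_space_subspace] cfun.subspace_scale[OF U_space_subspace])
      ultimately show ?thesis
        using transfer_op_has_sum[of "fscale a f + g" z] True has_sum_unique
        by (simp add: fscale_def) blast
    next
      case False
      then show ?thesis by (simp add: transfer_op_def closure_D fscale_def)
    qed
  qed
qed

section \<open>Order of vanishing at the centre of the ball\<close>

definition \<rho> :: real where "\<rho> = R / real (CARD('d) + 1)"

lemma \<rho>_pos: "0 < \<rho>"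
  using R by (simp add: \<rho>_def)

lemma polydisc_subset_D:
  fixes x :: "complex^'d"
  assumes "x \<in> polydisc \<rho>"
  shows "c + x \<in> D"
  using polydisc_norm_less[OF assms \<rho>_pos] R by (simp add: D dist_norm \<rho>_def add_pos_pos)

lemma U_space_sep_holo:
  assumes f: "f \<in> U_space D"
  shows "(\<lambda>x. f (c + x)) \<in> sep_holo \<rho>"
  unfolding sep_holo_def
proof (intro CollectI conjI ballI allI)
  obtain M where M: "\<And>z. z \<in> K \<Longrightarrow> norm (f z) \<le> M"
    by (rule continuous_K_bound[OF U_space_continuous[OF f]]) (rule that)
  show "\<exists>M. \<forall>x\<in>polydisc \<rho>. norm (f (c + x)) \<le> M"
  proof (intro exI[of _ M] ballI M)
    fix x :: "complex^'d" assume "x \<in> polydisc \<rho>"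
    then show "c + x \<in> K" using polydisc_subset_D[of x] by (simp add: D)
  qed
  fix x :: "complex^'d" and j assume x: "x \<in> polydisc \<rho>"
  define a where "a = c + upd x j 0"
  have eq: "c + upd x j s = a + s *s axis j 1" for s
    by (simp add: a_def Finite_Cartesian_Product.vec_eq_iff upd_def axis_def)
  show "(\<lambda>s. f (c + upd x j s)) holomorphic_on ball 0 \<rho>"
    unfolding eq
  proof (rule holo_on_line_holomorphic)
    show "holo_on (*) f D" using f by (simp add: U_space_def in_U_def)
    show "a + s *s axis j 1 \<in> D" if "s \<in> ball 0 \<rho>" for s
      unfolding eq[symmetric] by (intro polydisc_subset_D upd_polydisc x) (use that in simp)
  qed
qed

text \<open>Translation to the centre maps \<open>U_space D\<close> linearly into
  \<open>sep_holo \<rho>\<close>, so the functionals found there can be pulled back without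
  increasing their number.\<close>

lemma ex_order_functionals:
  "\<exists>S. finite S \<and> card S \<le> (CARD('d) + m - 1) choose CARD('d) \<and>
    (\<forall>\<phi>\<in>S. linear_functional_on (U_space D) \<phi>) \<and>
    (\<forall>f\<in>U_space D. (\<forall>\<phi>\<in>S. \<phi> f = 0) \<longrightarrow> vanishes_to \<rho> m (\<lambda>x. f (c + x)))"
proof -
  obtain S0 where S0: "vanishing_functionals \<rho> (UNIV :: 'd set) m S0"
    "card S0 \<le> (CARD('d) + m - 1) choose CARD('d)"
    using ex_vanishing_functionals[OF \<rho>_pos, where J="UNIV :: 'd set" and m=m] by (elim exE conjE)
  let ?S = "(\<lambda>\<phi> f. \<phi> (\<lambda>x. f (c + x))) ` S0"
  have fin: "finite S0" using S0(1) by (simp add: vanishing_functionals_def)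
  show ?thesis
  proof (intro exI[of _ ?S] conjI ballI impI)
    show "finite ?S" using fin by simp
    show "card ?S \<le> (CARD('d) + m - 1) choose CARD('d)"
      using card_image_le[OF fin, of "\<lambda>\<phi> f. \<phi> (\<lambda>x. f (c + x))"] S0(2) by linarith
  next
    fix \<phi> assume "\<phi> \<in> ?S"
    then obtain \<psi> where \<psi>: "\<psi> \<in> S0" "\<phi> = (\<lambda>f. \<psi> (\<lambda>x. f (c + x)))" by blast
    then have "linear_functional_on (sep_holo \<rho>) \<psi>"
      using S0(1) by (simp add: vanishing_functionals_def)
    then show "linear_functional_on (U_space D) \<phi>"
      by (simp add: \<psi>(2) linear_functional_on_def U_space_sep_holo)
  next
    fix f assume f: "f \<in> U_space D" and "\<forall>\<phi>\<in>?S. \<phi> f = 0"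
    then have "\<forall>\<psi>\<in>S0. \<psi> (\<lambda>x. f (c + x)) = 0" by simp
    then show "vanishes_to \<rho> m (\<lambda>x. f (c + x))"
      by (intro vanishing_functionalsD[OF S0(1)] IntI U_space_sep_holo f depends_on_UNIV)
  qed
qed

text \<open>Each term of the determinant has one factor from every row, so the orders
  \<open>m j\<close> add up. The points are blown up by \<open>1 / r\<close> about the centre
  beforehand: then \<open>h\<close> is bounded by \<open>M\<close> on the unit disc and the given
  configuration is reached at \<open>s = r\<close>.\<close>

lemma fdet_contraction:
  assumes g: "\<And>j. j < n \<Longrightarrow> g j \<in> U_space D"
    and ord: "\<And>j. j < n \<Longrightarrow> vanishes_to \<rho> (m j) (\<lambda>x. g j (c + x))"
    and M: "\<And>x. (\<And>k. k < n \<Longrightarrow> x k \<in> K) \<Longrightarrow> norm (fdet n (\<lambda>j k. g j (x k))) \<le> M"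
    and y: "\<And>k. k < n \<Longrightarrow> y k \<in> cball c (r * R)"
  shows "norm (fdet n (\<lambda>j k. g j (y k))) \<le> M * r ^ (\<Sum>j<n. m j)"
proof -
  define u where "u k = inverse (complex_of_real r) *s (y k - c)" for k
  have u: "norm (u k) \<le> R" if "k < n" for k
  proof -
    have "norm (y k - c) \<le> r * R" using y[OF that] by (simp add: dist_norm norm_minus_commute)
    moreover have "norm (inverse (complex_of_real r)) = inverse r" using r by (simp add: norm_inverse)
    ultimately show ?thesis
      unfolding u_def norm_vector_scalar_mult using r by (simp only:) (simp add: field_simps)
  qed
  have yu: "y k = c + complex_of_real r *s u k" for k
    using r by (simp add: u_def vector_smult_assoc)
  define h where "h s = fdet n (\<lambda>j k. g j (c + s *s u k))" for s
  have su: "norm (s *s u k) \<le> norm s * R" if "k < n" for s k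
    using u[OF that] by (simp add: norm_vector_scalar_mult mult_left_mono)
  have hol: "h holomorphic_on ball 0 1"
    unfolding h_def fdet_expand
  proof (intro holomorphic_intros)
    fix p i assume p: "p \<in> {p. p permutes {0..<n}}" and i: "i \<in> {0..<n}"
    then have "p i < n" using permutes_in_image[of p "{0..<n}" i] by auto
    show "(\<lambda>s. g i (c + s *s u (p i))) holomorphic_on ball 0 1"
    proof (rule holo_on_line_holomorphic)
      show "holo_on (*) (g i) D" using g[of i] i by (simp add: U_space_def in_U_def)
      show "c + s *s u (p i) \<in> D" if "s \<in> ball 0 1" for s
      proof -
        have "norm s * R < 1 * R" using that R by (intro mult_strict_right_mono) auto
        then show ?thesis using su[OF \<open>p i < n\<close>, of s] by (simp add: D dist_norm)
      qed
    qed
  qed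
  have bound: "norm (h s) \<le> M" if "norm s < 1" for s
    unfolding h_def
  proof (rule M)
    fix k assume "k < n"
    have "norm s * R \<le> 1 * R" using that R by (intro mult_right_mono) auto
    then show "c + s *s u k \<in> K" using su[OF \<open>k < n\<close>, of s] by (simp add: dist_norm)
  qed
  have "\<exists>C\<ge>0. \<forall>x. norm x \<le> R \<longrightarrow> norm (g j (c + x)) \<le> C * norm x ^ m j" if j: "j < n" for j
  proof -
    obtain M where M: "\<And>z. z \<in> K \<Longrightarrow> norm (g j z) \<le> M"
      by (rule continuous_K_bound[OF U_space_continuous[OF g[OF j]]]) (rule that)
    show ?thesis
      by (rule vanishes_to_bounded_extension[OF ord[OF j] \<rho>_pos, of R M]) (use M in \<open>simp add: dist_norm\<close>)
  qed
  then obtain C where C: "\<And>j. j < n \<Longrightarrow> C j \<ge> 0"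
    "\<And>j x. j < n \<Longrightarrow> norm x \<le> R \<Longrightarrow> norm (g j (c + x)) \<le> C j * norm x ^ m j" by metis
  have order: "norm (h s) \<le> (fact n * (\<Prod>j=0..<n. C j * R ^ m j)) * norm s ^ (\<Sum>j<n. m j)"
    if s: "norm s < 1" for s
  proof -
    have "norm (h s) \<le> fact n * (\<Prod>j=0..<n. C j * (norm s * R) ^ m j)"
      unfolding h_def
    proof (rule norm_fdet_le)
      fix j k assume jk: "j < n" "k < n"
      have "norm s * R \<le> 1 * R" using s R by (intro mult_right_mono) auto
      then have "norm (s *s u k) \<le> R" using su[OF jk(2), of s] by simp
      then have "norm (g j (c + s *s u k)) \<le> C j * norm (s *s u k) ^ m j" using C(2) jk by blast
      also have "\<dots> \<le> C j * (norm s * R) ^ m j"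
        using su[OF jk(2), of s] C(1)[OF jk(1)] by (intro mult_left_mono power_mono) auto
      finally show "norm (g j (c + s *s u k)) \<le> C j * (norm s * R) ^ m j" .
    qed
    also have "(\<Prod>j=0..<n. C j * (norm s * R) ^ m j) = (\<Prod>j=0..<n. C j * R ^ m j) * norm s ^ (\<Sum>j<n. m j)"
      by (simp add: power_mult_distrib prod.distrib power_sum lessThan_atLeast0 mult_ac)
    finally show ?thesis by (simp add: mult.assoc)
  qed
  have "norm (h (complex_of_real r)) \<le> M * norm (complex_of_real r) ^ (\<Sum>j<n. m j)"
    by (rule Schwarz_higher_order[OF hol bound order]) (use r in auto)
  then show ?thesis using r by (simp add: h_def yu[symmetric])
qed

text \<open>The operator makes the column at \<open>x k\<close> a sum, with weights
  \<open>w i (x k)\<close>, of the columns of values of \<open>g\<close> at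
  \<open>T i (x k)\<close>. The admissible columns are the vectors of values at a common point of
  the smaller ball.\<close>

lemma norm_fdet_transfer_op_le:
  assumes g: "\<And>j. j < n \<Longrightarrow> g j \<in> U_space D" and x: "\<And>k. k < n \<Longrightarrow> x k \<in> K"
    and B: "\<And>y. (\<And>k. k < n \<Longrightarrow> y k \<in> cball c (r * R)) \<Longrightarrow> norm (fdet n (\<lambda>j k. g j (y k))) \<le> B"
  shows "norm (fdet n (\<lambda>j k. transfer_op D I T w (g j) (x k))) \<le> W ^ n * B"
proof (rule norm_fdet_average_le[where I=I and a="\<lambda>k i. w i (x k)" and v="\<lambda>k i j. g j (T i (x k))"
      and Y="(\<lambda>z j. g j z) ` cball c (r * R)"])
  show "((\<lambda>i. w i (x k) * g j (T i (x k))) has_sum transfer_op D I T w (g j) (x k)) I"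
    if "k < n" "j < n" for k j by (intro transfer_op_has_sum g x that)
  show "(\<lambda>i. norm (w i (x k))) summable_on I" "(\<Sum>\<^sub>\<infinity>i\<in>I. norm (w i (x k))) \<le> W" if "k < n" for k
    by (intro w_abs_summable w_sum_le_W x that)+
  show "(\<lambda>j. g j (T i (x k))) \<in> (\<lambda>z j. g j z) ` cball c (r * R)" if "k < n" "i \<in> I" for k i
    by (intro imageI T_cball x that)
  show "(\<lambda>z j. g j z) ` cball c (r * R) \<noteq> {}" using R r by (simp add: not_less)
  fix y assume "\<And>k. k < n \<Longrightarrow> y k \<in> (\<lambda>z j. g j z) ` cball c (r * R)"
  then have "\<forall>k. \<exists>z. k < n \<longrightarrow> z \<in> cball c (r * R) \<and> y k = (\<lambda>j. g j z)" by blast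
  then obtain z where z: "\<And>k. k < n \<Longrightarrow> z k \<in> cball c (r * R) \<and> y k = (\<lambda>j. g j (z k))" by metis
  have "fdet n (\<lambda>j k. y k j) = fdet n (\<lambda>j k. g j (z k))" by (rule fdet_cong) (use z in simp)
  then show "norm (fdet n (\<lambda>j k. y k j)) \<le> B" using B[of z] z by simp
qed

text \<open>With \<open>g = Q f\<close> and \<open>L f = A f\<close>, where \<open>A\<close> is
  lower triangular, both determinants contain the factor \<open>fdet n Q\<close>, so the change of
  basis leaves the product of the eigenvalues untouched.\<close>

lemma fdet_transfer_op_triangular:
  assumes tri: "triangular_seq (U_space D) (transfer_op D I T w) lam f n"
    and g: "\<And>p. p < n \<Longrightarrow> g p \<in> cfun.span (f ` {..<n})"
  shows "fdet n (\<lambda>j k. transfer_op D I T w (g j) (x k)) = (\<Prod>j<n. lam j) * fdet n (\<lambda>j k. g j (x k))"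
proof -
  let ?L = "transfer_op D I T w"
  interpret linear_endo "U_space D" ?L by (rule transfer_op_linear_endo)
  have "\<exists>q. \<forall>z. g p z = (\<Sum>j<n. q j * f j z)" if "p < n" for p
    by (rule span_lessThan_coords[OF g[OF that]]) blast
  then obtain Q where Q: "\<And>p z. p < n \<Longrightarrow> g p z = (\<Sum>j<n. Q p j * f j z)" by metis
  have "\<exists>q. \<forall>z. (?L (f j) - fscale (lam j) (f j)) z = (\<Sum>l<j. q l * f l z)" if "j < n" for j
  proof -
    have "?L (f j) - fscale (lam j) (f j) \<in> cfun.span (f ` {..<j})"
      using tri that by (simp only: triangular_seq_def)
    then show ?thesis by (rule span_lessThan_coords) blast
  qed
  then obtain P where P: "\<And>j z. j < n \<Longrightarrow> (?L (f j) - fscale (lam j) (f j)) z = (\<Sum>l<j. P j l * f l z)"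
    by metis
  define A where "A j l = (if l < j then P j l else if l = j then lam j else 0)" for j l
  have A: "?L (f j) z = (\<Sum>l<n. A j l * f l z)" if "j < n" for j z
  proof -
    have "(\<Sum>l<n. A j l * f l z) = (\<Sum>l\<in>{..<Suc j}. A j l * f l z)"
      by (rule sum.mono_neutral_right) (use that in \<open>auto simp: A_def\<close>)
    also have "\<dots> = (\<Sum>l<j. P j l * f l z) + lam j * f j z" by (simp add: A_def)
    also have "\<dots> = ?L (f j) z" using P[OF that, of z] by (simp add: fscale_def algebra_simps)
    finally show ?thesis by simp
  qed
  have fV: "f j \<in> U_space D" if "j < n" for j using tri that by (simp add: triangular_seq_def)
  have "fdet n (\<lambda>j k. ?L (g j) (x k)) = fdet n (\<lambda>j k. \<Sum>l<n. Q j l * (\<Sum>i<n. A l i * f i (x k)))"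
  proof (rule fdet_cong)
    fix j k assume "j < n" "k < n"
    have "?L (g j) (x k) = (\<Sum>l<n. Q j l * ?L (f l) (x k))"
      using map_combination[of n f "g j" "Q j" "x k"] fV Q[OF \<open>j < n\<close>] by blast
    then show "?L (g j) (x k) = (\<Sum>l<n. Q j l * (\<Sum>i<n. A l i * f i (x k)))" by (simp add: A)
  qed
  also have "\<dots> = fdet n Q * (fdet n A * fdet n (\<lambda>j k. f j (x k)))"
    by (simp only: fdet_mult)
  also have "fdet n A = (\<Prod>j<n. lam j)"
    by (subst fdet_lower_triangular) (auto simp: A_def)
  also have "fdet n Q * ((\<Prod>j<n. lam j) * fdet n (\<lambda>j k. f j (x k))) =
      (\<Prod>j<n. lam j) * fdet n (\<lambda>j k. \<Sum>l<n. Q j l * f l (x k))"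
    by (simp add: fdet_mult)
  also have "fdet n (\<lambda>j k. \<Sum>l<n. Q j l * f l (x k)) = fdet n (\<lambda>j k. g j (x k))"
    by (rule fdet_cong) (simp add: Q)
  finally show ?thesis .
qed

text \<open>
  The supremum \<open>M\<close> of the determinant over all configurations in \<open>K\<close> cancels, so no
  extremal (Fekete) configuration is needed.
\<close>

lemma prod_eigenvalues_le:
  assumes ev: "eigenvalue_sequence (U_space D) (transfer_op D I T w) ev"
    and nz: "\<And>k. 1 \<le> k \<Longrightarrow> k \<le> n \<Longrightarrow> ev k \<noteq> 0"
  shows "norm (\<Prod>j<n. ev (Suc j)) \<le> W ^ n * r ^ (\<Sum>k<n. monomial_degree (CARD('d)) k)"
proof -
  let ?L = "transfer_op D I T w"
  let ?m = "monomial_degree (CARD('d))"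
  obtain f where f: "triangular_seq (U_space D) ?L (\<lambda>j. ev (Suc j)) f n"
    using ex_triangular_seq[OF transfer_op_linear_endo ev nz] by blast
  then have fi: "indep_seq f n" and fV: "\<And>j. j < n \<Longrightarrow> f j \<in> U_space D"
    by (simp_all add: triangular_seq_def)
  have "\<forall>k. \<exists>S. finite S \<and> card S \<le> (CARD('d) + ?m k - 1) choose CARD('d) \<and>
      (\<forall>\<phi>\<in>S. linear_functional_on (U_space D) \<phi>) \<and>
      (\<forall>f\<in>U_space D. (\<forall>\<phi>\<in>S. \<phi> f = 0) \<longrightarrow> vanishes_to \<rho> (?m k) (\<lambda>x. f (c + x)))"
    using ex_order_functionals by blast
  from choice[OF this] obtain S where S:
    "\<forall>k. finite (S k) \<and> card (S k) \<le> (CARD('d) + ?m k - 1) choose CARD('d) \<and>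
      (\<forall>\<phi>\<in>S k. linear_functional_on (U_space D) \<phi>) \<and>
      (\<forall>f\<in>U_space D. (\<forall>\<phi>\<in>S k. \<phi> f = 0) \<longrightarrow> vanishes_to \<rho> (?m k) (\<lambda>x. f (c + x)))" ..
  \<comment> \<open>This is where the choice of degrees is used: order \<open>?m k\<close> costs no
    more than the \<open>k\<close> conditions that \<open>ex_graded_basis\<close> affords.\<close>
  have "finite (S k) \<and> card (S k) \<le> k \<and> (\<forall>\<phi>\<in>S k. linear_functional_on (U_space D) \<phi>)" for k
    using S[rule_format, of k] monomial_degree_properties(2)[of "CARD('d)" k]
    by (auto simp: Suc_le_eq)
  then obtain g where g: "indep_seq g n" "\<And>p. p < n \<Longrightarrow> g p \<in> cfun.span (f ` {..<n})"
    "\<And>p \<phi>. p < n \<Longrightarrow> \<phi> \<in> S (n - Suc p) \<Longrightarrow> \<phi> (g p) = 0"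
    using ex_graded_basis[OF fi fV U_space_subspace] by metis
  have gV: "g p \<in> U_space D" if "p < n" for p
    using g(2)[OF that] cfun.span_minimal[OF _ U_space_subspace, of "f ` {..<n}" D] fV by blast
  \<comment> \<open>The index reversal inherited from \<open>ex_graded_basis\<close> disappears in
    the sum of the orders.\<close>
  have ord: "vanishes_to \<rho> (?m (n - Suc p)) (\<lambda>x. g p (c + x))" if "p < n" for p
    using S gV[OF that] g(3)[OF that] by blast
  let ?G = "\<lambda>x. fdet n (\<lambda>j k. g j (x k))"
  let ?X = "{x. \<forall>k<n. x k \<in> K}"
  define M where "M = (SUP x\<in>?X. norm (?G x))"
  have "\<forall>j\<in>{..<n}. \<exists>b. \<forall>z\<in>K. norm (g j z) \<le> b"
  proof
    fix j assume "j \<in> {..<n}"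
    then have "continuous_on K (g j)" by (intro U_space_continuous gV) simp
    then show "\<exists>b. \<forall>z\<in>K. norm (g j z) \<le> b" by (rule continuous_K_bound) blast
  qed
  then obtain b where b: "\<And>j z. j < n \<Longrightarrow> z \<in> K \<Longrightarrow> norm (g j z) \<le> b j" by (metis lessThan_iff)
  have bdd: "bdd_above ((\<lambda>x. norm (?G x)) ` ?X)"
    by (rule bdd_aboveI2[where M="fact n * (\<Prod>j=0..<n. b j)"]) (intro norm_fdet_le, use b in simp)
  have M: "norm (?G x) \<le> M" if "\<And>k. k < n \<Longrightarrow> x k \<in> K" for x
    unfolding M_def by (rule cSUP_upper[OF _ bdd]) (use that in simp)
  obtain x0 where x0: "?G x0 \<noteq> 0" "\<forall>k<n. \<exists>j<n. g j (x0 k) \<noteq> 0"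
    using indep_seq_fdet_nonzero[OF g(1)] by blast
  \<comment> \<open>Members of \<open>U_space D\<close> vanish off \<open>K\<close>, so a point at
    which some \<open>g j\<close> is non-zero lies in \<open>K\<close>.\<close>
  have "x0 k \<in> K" if "k < n" for k
    using x0(2) that gV by (force simp: U_space_def closure_D)
  then have "norm (?G x0) \<le> M" by (rule M)
  then have Mpos: "0 < M" using x0(1) by (meson less_le_trans zero_less_norm_iff)
  define S' where "S' = (\<Sum>k<n. ?m k)"
  have S'_eq: "(\<Sum>p<n. ?m (n - Suc p)) = S'"
    unfolding S'_def by (rule sum.nat_diff_reindex)
  have contr: "norm (?G y) \<le> M * r ^ S'" if "\<And>k. k < n \<Longrightarrow> y k \<in> cball c (r * R)" for y
    unfolding S'_eq[symmetric] by (rule fdet_contraction[OF gV ord M that])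
  let ?P = "norm (\<Prod>j<n. ev (Suc j))"
  have step: "?P * norm (?G x) \<le> W ^ n * (M * r ^ S')" if "\<And>k. k < n \<Longrightarrow> x k \<in> K" for x
  proof -
    have "norm (fdet n (\<lambda>j k. ?L (g j) (x k))) \<le> W ^ n * (M * r ^ S')"
      by (rule norm_fdet_transfer_op_le) (use gV that contr in auto)
    moreover have "fdet n (\<lambda>j k. ?L (g j) (x k)) = (\<Prod>j<n. ev (Suc j)) * ?G x"
      by (rule fdet_transfer_op_triangular[OF f]) (rule g(2))
    ultimately show ?thesis by (simp add: norm_mult)
  qed
  have Ppos: "0 < ?P" using nz by (simp add: prod_zero_iff)
  have "M \<le> W ^ n * (M * r ^ S') / ?P"
    unfolding M_def
  proof (rule cSUP_least)
    show "?X \<noteq> {}" using R by (auto intro!: exI[of _ "\<lambda>_. c"])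
    fix x assume "x \<in> ?X"
    then show "norm (?G x) \<le> W ^ n * ((SUP x\<in>?X. norm (?G x)) * r ^ S') / ?P"
      using step[of x] Ppos by (simp add: M_def pos_le_divide_eq mult.commute)
  qed
  then have "?P * M \<le> (W ^ n * r ^ S') * M"
    using Ppos by (simp add: pos_le_divide_eq mult_ac)
  then show ?thesis using Mpos by (simp add: S'_def)
qed

lemma W_nonneg: "0 \<le> W"
proof -
  have "0 \<le> (\<Sum>\<^sub>\<infinity>i\<in>I. norm (w i c))" by (rule infsum_nonneg) simp
  also have "\<dots> \<le> W" by (rule w_sum_le_W) (use R in simp)
  finally show ?thesis .
qed

text \<open>Monotonicity bounds \<open>norm (ev n) ^ n\<close> by the product of the first
  \<open>n\<close> moduli; it also makes these entries non-zero whenever \<open>ev n\<close> is, as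
  the triangular basis demands.\<close>

lemma norm_eigenvalue_power_le:
  assumes ev: "eigenvalue_sequence (U_space D) (transfer_op D I T w) ev" and "1 \<le> n"
  shows "norm (ev n) ^ n \<le> W ^ n * r ^ (\<Sum>k<n. monomial_degree (CARD('d)) k)"
proof (cases "ev n = 0")
  case True
  then show ?thesis using W_nonneg r \<open>1 \<le> n\<close> by (simp add: power_0_left)
next
  case False
  have mono: "norm (ev n) \<le> norm (ev k)" if "1 \<le> k" "k \<le> n" for k
    using ev that by (simp add: eigenvalue_sequence_def)
  have "norm (ev n) ^ n = (\<Prod>j<n. norm (ev n))" by simp
  also have "\<dots> \<le> (\<Prod>j<n. norm (ev (Suc j)))"
    by (rule prod_mono) (use mono in auto)
  also have "\<dots> = norm (\<Prod>j<n. ev (Suc j))" by (simp add: prod_norm)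
  also have "\<dots> \<le> W ^ n * r ^ (\<Sum>k<n. monomial_degree (CARD('d)) k)"
  proof (rule prod_eigenvalues_le[OF ev])
    fix k assume "1 \<le> k" "k \<le> n"
    from mono[OF this] False show "ev k \<noteq> 0" by auto
  qed
  finally show ?thesis .
qed

end

text \<open>For \<open>W = 0\<close> the operator is zero and so is every \<open>ev n\<close> with
  \<open>n \<ge> 1\<close>; both sides then vanish, so the strict inequality requires
  \<open>W \<noteq> 0\<close>. The operator is formed from the chosen extensions \<open>T'\<close>
  and \<open>w'\<close> on \<open>D\<close>.\<close>

theorem corollary4p4:
  fixes X D :: "(complex^'d) set"
    and I :: "'i set"
    and T T' :: "'i \<Rightarrow> complex^'d \<Rightarrow> complex^'d"
    and w w' :: "'i \<Rightarrow> complex^'d \<Rightarrow> complex"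
    and c :: "complex^'d" and R r W :: real
    and ev :: "nat \<Rightarrow> complex" and d :: nat
  assumes "d = CARD('d)"
    and "compact X"
    and "Comega_map_weight_system X I T w"
    and "0 < R" and "D = ball c R"
    and "admissible_map X I T D T'" and "admissible_weight X I w D w'"
    and "0 < r" and "r < 1"
    and "(\<Union>i\<in>I. T' i ` D) \<subseteq> ball c (r * R)"
    and "W = (SUP z\<in>D. \<Sum>\<^sub>\<infinity>i\<in>I. norm (w' i z))"
    and "W \<noteq> 0"
    and "eigenvalue_sequence (U_space D) (transfer_op D I T' w') ev"
  shows "\<forall>n\<ge>1. norm (ev n) <
           min (real n powr (1/2))
               (sqrt (real d) / (1 - r\<^sup>2) powr (real d / 2)
                  * real n powr ((real d - 1) / (2 * real d)))
           * (W / r ^ d)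
           * r powr (real d / (real d + 1) * (fact d) powr (1 / real d) * real n powr (1 / real d))"
proof (intro allI impI)
  fix n :: nat assume n: "1 \<le> n"
  interpret ball_system c R r W D I T' w'
  proof
    show "\<And>i. i \<in> I \<Longrightarrow> in_U (*s) D (T' i)"
      using assms(6) by (simp add: admissible_map_def holomorphic_map_system_def)
    show "\<And>i. i \<in> I \<Longrightarrow> in_U (*) D (w' i)" "(\<lambda>i. U_norm D (w' i)) summable_on I"
      using assms(7) by (simp_all add: admissible_weight_def holomorphic_weight_system_def)
    show "\<And>i z. i \<in> I \<Longrightarrow> z \<in> D \<Longrightarrow> T' i z \<in> ball c (r * R)"
      using assms(10) by blast
  qed (fact assms)+
  have "0 < W" using W_nonneg assms(12) by simp
  moreover have "1 \<le> d" unfolding assms(1) by (simp add: Suc_le_eq)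
  ultimately show "norm (ev n) <
           min (real n powr (1/2))
               (sqrt (real d) / (1 - r\<^sup>2) powr (real d / 2)
                  * real n powr ((real d - 1) / (2 * real d)))
           * (W / r ^ d)
           * r powr (real d / (real d + 1) * (fact d) powr (1 / real d) * real n powr (1 / real d))"
    using norm_eigenvalue_power_le[OF assms(13) n] n r
    by (intro eigenvalue_bound_arithmetic) (simp_all add: assms(1))
qed

end
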